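(* Let $n\ge 1$, let $f_1,\dots,f_n:\mathsf H\to\mathbb R$ be functions on a separable real Hilbert space $\mathsf H$, let $F=\frac1n\sum_{i=1}^n f_i$, and assume $\operatorname{argmin}F\neq\varnothing$. Assume that each $f_i$ is convex and $L$-smooth for some $L>0$, and that $F$ satisfies the Polyak–Łojasiewicz condition with constant $\mu>0$: $F(x)-F_*\le\frac1{2\mu}\|\nabla F(x)\|^2$ for all $x\in\mathsf H$. Let $(\tilde{\boldsymbol x}^s)_{s\in\mathbb N}$ be generated by the SVRP algorithm described in the context (with either of its two options for $\tilde{\boldsymbol x}^{s+1}$), with step size $\alpha$ and number of inner iterations $m$ satisfying $$0<\alpha<\frac1{2(2L-\mu)}\qquad\text{and}\qquad m>\frac1{\mu\alpha(1-2\alpha(2L-\mu))}.$$ Then, for all $s\in\mathbb N$, $$\mathsf E\big[F(\tilde{\boldsymbol x}^{s+1})-F_*\big]\le q^s\big(F(\tilde{\boldsymbol x}^0)-F_*\big),\qquad\text{with}\quad q:=\frac1{\mu\alpha(1-2L\alpha)m}+\frac{2\alpha(L-\mu)}{1-2L\alpha}<1.$$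
   Context: Notation: $F_*=\inf F$; $\operatorname{prox}_{\varphi}(x)=\operatorname{argmin}_{y\in\mathsf H}\{\varphi(y)+\frac12\|y-x\|^2\}$; $\delta_{k,h}$ is the Kronecker symbol. A function $f$ is $L$-smooth if it is differentiable and $\|\nabla f(x)-\nabla f(y)\|\le L\|x-y\|$ for all $x,y\in\mathsf H$. SVRP algorithm: let $m\ge1$ be an integer, and let $(\xi_s)_{s\in\mathbb N}$ and $(i_t)_{t\in\mathbb N}$ be two independent sequences of i.i.d. random variables uniformly distributed on $\{0,1,\dots,m-1\}$ and $\{1,\dots,n\}$, respectively. Let $\alpha>0$ and let $\tilde{\boldsymbol x}^0\in\mathsf H$ be a deterministic initial point. For $s=0,1,\dots$: set $\boldsymbol x^0=\tilde{\boldsymbol x}^s$; for $k=0,\dots,m-1$ set $$\boldsymbol x^{k+1}=\operatorname{prox}_{\alpha f_{i_{sm+k}}}\big(\boldsymbol x^k+\alpha\nabla f_{i_{sm+k}}(\tilde{\boldsymbol x}^s)-\alpha\nabla F(\tilde{\boldsymbol x}^s)\big)$$ (the inner iterates $\boldsymbol x^k$ are recomputed for each $s$); then set either $\tilde{\boldsymbol x}^{s+1}=\sum_{k=0}^{m-1}\delta_{k,\xi_s}\boldsymbol x^k$ (first option) or $\tilde{\boldsymbol x}^{s+1}=\frac1m\sum_{k=0}^{m-1}\boldsymbol x^k$ (second option).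
   Formalization: The claim q<1 is asserted only if F is nonconstant or 2Lα<1: for constant F it can fail (n=1, f=0, L=1, μ=1.5, α=0.6, m=3 gives q≈1.15), and for constant F with 2Lα≥1 it never holds (q>1 or undefined). The expectation bound is unrestricted. *)

theory Defs
  imports "HOL-Probability.Probability"
begin

text \<open>
  A separable real Hilbert space is a type of sort \<open>{real_inner, polish_space}\<close>: for metric spaces
  second countability is the same as separability, and \<open>polish_space\<close> also supplies completeness.
\<close>

definition grad :: "('a::real_inner \<Rightarrow> real) \<Rightarrow> 'a \<Rightarrow> 'a"
  where "grad f x = (THE D. GDERIV f x :> D)"

definition L_smooth :: "real \<Rightarrow> ('a::real_inner \<Rightarrow> real) \<Rightarrow> bool"
  where "L_smooth L f \<longleftrightarrow>
    (\<forall>x. f differentiable (at x)) \<and> (\<forall>x y. norm (grad f x - grad f y) \<le> L * norm (x - y))"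

definition PL_condition :: "real \<Rightarrow> ('a::real_inner \<Rightarrow> real) \<Rightarrow> bool"
  where "PL_condition \<mu> F \<longleftrightarrow> (\<forall>x. F x - (INF y. F y) \<le> 1 / (2 * \<mu>) * (norm (grad F x))\<^sup>2)"

text \<open>\<open>arg_min\<close> selects some minimizer; for convex continuous \<open>\<phi>\<close> on a Hilbert space
  there is exactly one.\<close>

definition prox :: "('a::real_inner \<Rightarrow> real) \<Rightarrow> 'a \<Rightarrow> 'a"
  where "prox \<phi> x = (ARG_MIN (\<lambda>y. \<phi> y + 1 / 2 * (norm (y - x))\<^sup>2) y. True)"

definition average :: "nat \<Rightarrow> (nat \<Rightarrow> 'a \<Rightarrow> real) \<Rightarrow> 'a \<Rightarrow> real"
  where "average n f x = 1 / real n * (\<Sum>i = 1..n. f i x)"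

datatype svrp_update = Random_Iterate | Average_Iterate

text \<open>
  Both functions below describe one realization of the algorithm: the sequences
  \<open>\<xi>, idx :: nat \<Rightarrow> nat\<close> are sample paths. The argument \<open>xt\<close> of \<open>svrp_inner\<close> is
  the current outer iterate.
\<close>

primrec svrp_inner ::
  "real \<Rightarrow> nat \<Rightarrow> nat \<Rightarrow> (nat \<Rightarrow> 'a::real_inner \<Rightarrow> real) \<Rightarrow> (nat \<Rightarrow> nat) \<Rightarrow> nat \<Rightarrow> 'a \<Rightarrow> nat \<Rightarrow> 'a"
where
  "svrp_inner \<alpha> m n f idx s xt 0 = xt"
| "svrp_inner \<alpha> m n f idx s xt (Suc k) =
    prox (\<lambda>y. \<alpha> * f (idx (s * m + k)) y)
      (svrp_inner \<alpha> m n f idx s xt k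
        + \<alpha> *\<^sub>R grad (f (idx (s * m + k))) xt - \<alpha> *\<^sub>R grad (average n f) xt)"

primrec svrp ::
  "svrp_update \<Rightarrow> real \<Rightarrow> nat \<Rightarrow> nat \<Rightarrow> (nat \<Rightarrow> 'a::real_inner \<Rightarrow> real) \<Rightarrow> 'a \<Rightarrow>
    (nat \<Rightarrow> nat) \<Rightarrow> (nat \<Rightarrow> nat) \<Rightarrow> nat \<Rightarrow> 'a"
where
  "svrp upd \<alpha> m n f x0 \<xi> idx 0 = x0"
| "svrp upd \<alpha> m n f x0 \<xi> idx (Suc s) =
    (let x = svrp_inner \<alpha> m n f idx s (svrp upd \<alpha> m n f x0 \<xi> idx s)
     in case upd of
          Random_Iterate \<Rightarrow> (\<Sum>k<m. (if k = \<xi> s then 1 else 0) *\<^sub>R x k)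
        | Average_Iterate \<Rightarrow> (1 / real m) *\<^sub>R (\<Sum>k<m. x k))"

end

theory Submission
  imports Defs
begin

text \<open>
  For a minimizer \<open>p\<close>, convexity and the optimality condition of the proximal step give, after averaging
  over the index, \<open>E \<parallel>x\<^sup>+ - p\<parallel>\<^sup>2 \<le> \<parallel>x - p\<parallel>\<^sup>2 - 2 \<alpha> (F x - F p) + \<alpha>\<^sup>2 E \<parallel>w\<parallel>\<^sup>2\<close>, where \<open>w\<close> is the
  variance-reduced gradient estimator at \<open>x\<close> with anchor \<open>z\<close>. Cocoercivity of the gradients and the
  Polyak-Lojasiewicz inequality bound \<open>E \<parallel>w\<parallel>\<^sup>2\<close> by \<open>4 L (F x - F p) + 4 (L - \<mu>) (F z - F p)\<close>. Summing
  over an inner loop started at \<open>z\<close>, and using that the Polyak-Lojasiewicz inequality implies quadratic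
  growth, \<open>\<mu> / 2 * dist\<^sup>2(z, argmin F) \<le> F z - F p\<close>, yields contraction of the expected gap by \<open>q\<close>.
  Distances are measured to a minimizer attaining the growth bound only up to \<open>\<epsilon>\<close>, so projections onto
  the solution set are not needed.

  If \<open>F\<close> is constant then \<open>\<mu> \<le> L\<close> may fail, but all gaps vanish.
\<close>

subsection \<open>Smooth convex functions on Hilbert spaces\<close>

lemma norm_midpoint_sq:
  fixes a b x :: "'a::real_inner"
  shows "(norm ((1/2) *\<^sub>R a + (1/2) *\<^sub>R b - x))\<^sup>2
    = ((norm (a - x))\<^sup>2 + (norm (b - x))\<^sup>2) / 2 - (norm (a - b))\<^sup>2 / 4"
  by (simp add: power2_norm_eq_inner inner_diff_left inner_diff_right inner_add_left inner_add_right
      inner_commute field_simps)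

lemma proximal_minimizer_exists:
  fixes \<phi> :: "'a::{real_inner, complete_space} \<Rightarrow> real"
  assumes conv: "convex_on UNIV \<phi>" and cont: "continuous_on UNIV \<phi>"
    and lower: "\<And>y. \<phi> y \<ge> c - K * norm (y - x)"
  shows "\<exists>y. \<forall>w. \<phi> y + 1/2 * (norm (y - x))\<^sup>2 \<le> \<phi> w + 1/2 * (norm (w - x))\<^sup>2"
proof -
  define \<psi> where "\<psi> w = \<phi> w + 1/2 * (norm (w - x))\<^sup>2" for w
  have "\<psi> w \<ge> c - K\<^sup>2 / 2" for w
  proof -
    have "0 \<le> (norm (w - x) - K)\<^sup>2" by simp
    then show ?thesis
      using lower[of w] by (simp add: \<psi>_def power2_diff algebra_simps)
  qed
  then have bdd: "bdd_below (range \<psi>)"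
    by (auto intro!: bdd_belowI)
  define I where "I = (INF w. \<psi> w)"
  have I_le: "I \<le> \<psi> w" for w
    unfolding I_def by (intro cINF_lower bdd) auto
  have "\<exists>y. \<psi> y < I + 1 / real (Suc n)" for n
    using cINF_less_iff[of UNIV \<psi> "I + 1 / real (Suc n)"] bdd by (auto simp: I_def)
  then obtain y where y: "\<And>n. \<psi> (y n) < I + 1 / real (Suc n)"
    by metis
  have gap: "(norm (a - b))\<^sup>2 / 8 \<le> (\<psi> a + \<psi> b) / 2 - I" for a b
  proof -
    have "\<phi> ((1/2) *\<^sub>R a + (1/2) *\<^sub>R b) \<le> (\<phi> a + \<phi> b) / 2"
      using convex_onD[OF conv, of "1/2" a b] by simp
    with I_le[of "(1/2) *\<^sub>R a + (1/2) *\<^sub>R b"] show ?thesis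
      by (simp add: \<psi>_def norm_midpoint_sq field_simps)
  qed
  have "Cauchy y"
  proof (rule CauchyI)
    fix e :: real assume e: "0 < e"
    obtain N where N: "1 / real (Suc N) < e\<^sup>2 / 8"
      using e nat_approx_posE[of "e\<^sup>2 / 8"] by auto
    have close: "\<psi> (y n) < I + e\<^sup>2 / 8" if "n \<ge> N" for n
    proof -
      have "1 / real (Suc n) \<le> 1 / real (Suc N)" using that by (simp add: frac_le)
      then show ?thesis using y[of n] N by linarith
    qed
    have "norm (y p - y q) < e" if "p \<ge> N" "q \<ge> N" for p q
    proof -
      have "(norm (y p - y q))\<^sup>2 < e\<^sup>2"
        using gap[of "y p" "y q"] close[OF that(1)] close[OF that(2)] by (simp add: field_simps)
      then show ?thesis using e by (simp add: power_less_imp_less_base)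
    qed
    then show "\<exists>M. \<forall>m\<ge>M. \<forall>n\<ge>M. norm (y m - y n) < e" by blast
  qed
  then obtain l where l: "y \<longlonglongrightarrow> l"
    using Cauchy_convergent_iff convergent_def by blast
  have "continuous_on UNIV \<psi>"
    unfolding \<psi>_def by (intro continuous_intros cont)
  then have "(\<lambda>n. \<psi> (y n)) \<longlonglongrightarrow> \<psi> l"
    using l continuous_on_tendsto_compose by fastforce
  moreover have "(\<lambda>n. I + 1 / real (Suc n)) \<longlonglongrightarrow> I + 0"
    by (intro tendsto_intros LIMSEQ_Suc[OF lim_1_over_n])
  ultimately have "\<psi> l \<le> I"
    using LIMSEQ_le[of "\<lambda>n. \<psi> (y n)" "\<psi> l" "\<lambda>n. I + 1 / real (Suc n)" I] y less_imp_le by auto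
  then show ?thesis
    using I_le unfolding \<psi>_def by (meson order_trans)
qed

text \<open>The representing vector of \<open>D\<close> is the minimizer of \<open>\<lambda>y. \<parallel>y\<parallel>\<^sup>2 / 2 - D y\<close>.\<close>
lemma riesz_representation:
  fixes D :: "'a::{real_inner, complete_space} \<Rightarrow> real"
  assumes "bounded_linear D"
  shows "\<exists>v. \<forall>h. D h = inner h v"
proof -
  interpret D: bounded_linear D by fact
  obtain K where K: "\<And>x. norm (D x) \<le> norm x * K" using D.bounded by blast
  have "convex_on UNIV (\<lambda>y. - D y)"
    by (intro convex_onI) (auto simp: D.add D.diff D.scaleR algebra_simps)
  moreover have "continuous_on UNIV (\<lambda>y. - D y)"
    by (intro continuous_intros D.continuous_on)
  moreover have "- D y \<ge> 0 - K * norm (y - 0)" for y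
    using K[of y] by (simp add: abs_le_iff mult.commute)
  ultimately obtain v where
    v: "\<And>w. - D v + 1/2 * (norm (v - 0))\<^sup>2 \<le> - D w + 1/2 * (norm (w - 0))\<^sup>2"
    using proximal_minimizer_exists[of "\<lambda>y. - D y" 0 K 0] by blast
  have "((\<lambda>w. - D w + 1/2 * inner w w) has_derivative (\<lambda>h. - D h + inner v h)) (at v)"
    by (auto intro!: derivative_eq_intros D.has_derivative simp: inner_commute)
  then have "(\<lambda>h. - D h + inner v h) = (\<lambda>h. 0)"
    by (rule differential_zero_maxmin[OF UNIV_I open_UNIV])
      (use v in \<open>auto simp: power2_norm_eq_inner\<close>)
  then show ?thesis
    by (auto simp: fun_eq_iff inner_commute intro!: exI[of _ v])
qed

lemma GDERIV_unique:
  assumes "GDERIV f x :> D" "GDERIV f x :> E"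
  shows "D = E"
proof -
  have "(\<lambda>h. inner h D) = (\<lambda>h. inner h E)"
    using assms has_derivative_unique unfolding gderiv_def by blast
  then have "inner (D - E) (D - E) = 0"
    by (metis inner_diff_right right_minus_eq)
  then show ?thesis by simp
qed

lemma grad_eqI: "GDERIV f x :> D \<Longrightarrow> grad f x = D"
  unfolding grad_def using GDERIV_unique by blast

lemma GDERIV_grad:
  fixes f :: "'a::{real_inner, complete_space} \<Rightarrow> real"
  assumes "f differentiable (at x)"
  shows "GDERIV f x :> grad f x"
proof -
  obtain D where D: "(f has_derivative D) (at x)"
    using assms by (auto simp: differentiable_def)
  obtain v where "\<And>h. D h = inner h v"
    using riesz_representation[OF has_derivative_bounded_linear[OF D]] by blast
  with D have "GDERIV f x :> v"
    unfolding gderiv_def by (metis (no_types, lifting) ext)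
  then show ?thesis by (simp add: grad_eqI)
qed

lemma L_smooth_GDERIV:
  fixes f :: "'a::{real_inner, complete_space} \<Rightarrow> real"
  shows "L_smooth L f \<Longrightarrow> GDERIV f x :> grad f x"
  by (simp add: GDERIV_grad L_smooth_def)

lemma GDERIV_line:
  assumes "GDERIV f (x + t *\<^sub>R h) :> G"
  shows "((\<lambda>t. f (x + t *\<^sub>R h)) has_field_derivative inner h G) (at t)"
proof -
  have "((\<lambda>t. x + t *\<^sub>R h) has_derivative (\<lambda>s. s *\<^sub>R h)) (at t)"
    by (auto intro!: derivative_eq_intros)
  from has_derivative_compose[OF this assms[unfolded gderiv_def]]
  show ?thesis by (simp add: has_field_derivative_def mult_commute_abs)
qed

lemma convex_above_tangent:
  assumes conv: "convex_on UNIV f" and G: "GDERIV f x :> G"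
  shows "f y \<ge> f x + inner (y - x) G"
proof -
  define g where "g t = f (x + t *\<^sub>R (y - x))" for t :: real
  have conv_g: "convex_on UNIV g"
  proof (rule convex_onI)
    fix t a b :: real assume t: "0 < t" "t < 1"
    have "x + ((1 - t) *\<^sub>R a + t *\<^sub>R b) *\<^sub>R (y - x)
      = (1 - t) *\<^sub>R (x + a *\<^sub>R (y - x)) + t *\<^sub>R (x + b *\<^sub>R (y - x))"
      by (simp add: algebra_simps)
    then show "g ((1 - t) *\<^sub>R a + t *\<^sub>R b) \<le> (1 - t) * g a + t * g b"
      using convex_onD[OF conv, of t "x + a *\<^sub>R (y - x)" "x + b *\<^sub>R (y - x)"] t
      by (simp add: g_def)
  qed simp
  have "(g has_field_derivative inner (y - x) G) (at 0)"
    unfolding g_def using GDERIV_line[of f x 0 "y - x" G] G by simp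
  from convex_on_imp_above_tangent[OF conv_g connected_UNIV _ UNIV_I this, of 1] show ?thesis
    by (simp add: g_def)
qed

lemma L_smooth_upper_bound:
  fixes f :: "'a::{real_inner, complete_space} \<Rightarrow> real"
  assumes f: "L_smooth L f"
  shows "f (x + h) \<le> f x + inner h (grad f x) + L / 2 * (norm h)\<^sup>2"
proof -
  define g where "g t = f (x + t *\<^sub>R h) - t * inner h (grad f x) - L / 2 * t\<^sup>2 * (norm h)\<^sup>2" for t
  have "\<exists>d. (g has_field_derivative d) (at t) \<and> d \<le> 0" if t: "0 \<le> t" "t \<le> 1" for t
  proof -
    have "(g has_field_derivative
        inner h (grad f (x + t *\<^sub>R h)) - inner h (grad f x) - L * t * (norm h)\<^sup>2) (at t)"
      unfolding g_def
      by (auto intro!: derivative_eq_intros GDERIV_line L_smooth_GDERIV[OF f])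
    moreover have "inner h (grad f (x + t *\<^sub>R h)) - inner h (grad f x) - L * t * (norm h)\<^sup>2 \<le> 0"
    proof -
      have "inner h (grad f (x + t *\<^sub>R h) - grad f x) \<le> norm h * norm (grad f (x + t *\<^sub>R h) - grad f x)"
        by (rule norm_cauchy_schwarz)
      also have "\<dots> \<le> norm h * (L * norm (x + t *\<^sub>R h - x))"
        using f by (intro mult_left_mono) (simp_all only: L_smooth_def norm_ge_zero)
      also have "\<dots> = L * t * (norm h)\<^sup>2" using t by (simp add: power2_eq_square)
      finally show ?thesis by (simp add: inner_diff_right)
    qed
    ultimately show ?thesis by blast
  qed
  from DERIV_nonpos_imp_nonincreasing[OF zero_le_one this] have "g 1 \<le> g 0" .
  then show ?thesis by (simp add: g_def)
qed

lemma grad_cocoercive: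
  fixes f :: "'a::{real_inner, complete_space} \<Rightarrow> real"
  assumes conv: "convex_on UNIV f" and f: "L_smooth L f" and L: "L > 0"
  shows "(norm (grad f x - grad f y))\<^sup>2 \<le> 2 * L * (f x - f y - inner (x - y) (grad f y))"
proof -
  define d where "d = grad f x - grad f y"
  have "f y + inner (x + (- (1/L)) *\<^sub>R d - y) (grad f y) \<le> f (x + (- (1/L)) *\<^sub>R d)"
    by (rule convex_above_tangent[OF conv L_smooth_GDERIV[OF f]])
  also have "\<dots> \<le> f x + inner ((- (1/L)) *\<^sub>R d) (grad f x) + L / 2 * (norm ((- (1/L)) *\<^sub>R d))\<^sup>2"
    by (rule L_smooth_upper_bound[OF f])
  finally have *: "0 \<le> f x - f y - inner (x - y) (grad f y) - (1/L) * inner d d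
      + L / 2 * (norm ((- (1/L)) *\<^sub>R d))\<^sup>2"
    by (simp add: d_def inner_diff_left inner_diff_right inner_add_left algebra_simps)
  have "L / 2 * (norm ((- (1/L)) *\<^sub>R d))\<^sup>2 = (norm d)\<^sup>2 / (2 * L)"
    using L by (simp add: power_mult_distrib field_simps power2_eq_square)
  with * have "(norm d)\<^sup>2 / (2 * L) \<le> f x - f y - inner (x - y) (grad f y)"
    by (simp add: power2_norm_eq_inner)
  then show ?thesis
    using L by (simp add: d_def[symmetric] pos_divide_le_eq mult.commute)
qed

lemma grad_minimizer:
  fixes f :: "'a::{real_inner, complete_space} \<Rightarrow> real"
  assumes "f differentiable (at x)" "\<And>y. f x \<le> f y"
  shows "grad f x = 0"
proof -
  have "(f has_derivative (\<lambda>h. inner h (grad f x))) (at x)"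
    using GDERIV_grad[OF assms(1)] by (simp add: gderiv_def)
  then have "(\<lambda>h. inner h (grad f x)) = (\<lambda>h. 0)"
    by (rule differential_zero_maxmin[OF UNIV_I open_UNIV]) (use assms in auto)
  then show ?thesis by (metis inner_eq_zero_iff)
qed

lemma prox_optimality:
  fixes \<phi> :: "'a::{real_inner, complete_space} \<Rightarrow> real"
  assumes conv: "convex_on UNIV \<phi>" and diff: "\<And>y. \<phi> differentiable (at y)"
  shows "x - prox \<phi> x = grad \<phi> (prox \<phi> x)"
proof -
  let ?\<psi> = "\<lambda>y. \<phi> y + 1/2 * (norm (y - x))\<^sup>2"
  have "continuous_on UNIV \<phi>"
    using diff by (meson continuous_at_imp_continuous_on differentiable_imp_continuous_within)
  moreover have "\<phi> y \<ge> \<phi> x - norm (grad \<phi> x) * norm (y - x)" for y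
    using convex_above_tangent[OF conv GDERIV_grad[OF diff], of x y]
      Cauchy_Schwarz_ineq2[of "y - x" "grad \<phi> x"] by (simp add: mult.commute abs_le_iff)
  ultimately have "\<exists>y. is_arg_min ?\<psi> (\<lambda>_. True) y"
    using proximal_minimizer_exists[OF conv] unfolding is_arg_min_linorder by blast
  then have "is_arg_min ?\<psi> (\<lambda>_. True) (prox \<phi> x)"
    unfolding prox_def arg_min_def by (rule someI_ex)
  then have min: "?\<psi> (prox \<phi> x) \<le> ?\<psi> w" for w
    by (auto simp: is_arg_min_linorder)
  let ?p = "prox \<phi> x"
  have "GDERIV \<phi> ?p :> grad \<phi> ?p" by (rule GDERIV_grad[OF diff])
  then have "GDERIV (\<lambda>y. \<phi> y + 1/2 * inner (y - x) (y - x)) ?p :> grad \<phi> ?p + (?p - x)"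
    unfolding gderiv_def
    by (auto intro!: derivative_eq_intros simp: inner_add_right inner_commute)
  then have \<psi>': "GDERIV ?\<psi> ?p :> grad \<phi> ?p + (?p - x)"
    by (simp add: power2_norm_eq_inner)
  then have "?\<psi> differentiable (at ?p)"
    unfolding gderiv_def by (rule differentiableI)
  from grad_minimizer[OF this min] have "grad \<phi> ?p + (?p - x) = 0"
    by (simp only: grad_eqI[OF \<psi>'])
  then show ?thesis by (simp add: algebra_simps add_eq_0_iff)
qed

subsection \<open>Quadratic growth\<close>

text \<open>The point is the limit of a sequence whose next term almost minimizes \<open>g\<close> over the nested closed
  sets \<open>S (Y k)\<close>.\<close>
lemma ekeland:
  fixes g :: "'a::complete_space \<Rightarrow> real"
  assumes cont: "continuous_on UNIV g" and lower: "\<And>y. b \<le> g y" and \<kappa>: "\<kappa> > 0"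
  shows "\<exists>y. \<kappa> * dist x y \<le> g x - g y \<and> (\<forall>z. g y - \<kappa> * dist y z \<le> g z)"
proof -
  define S where "S y = {z. g z + \<kappa> * dist y z \<le> g y}" for y
  have S_refl: "y \<in> S y" for y by (simp add: S_def)
  have S_trans: "w \<in> S y" if "z \<in> S y" "w \<in> S z" for w y z
  proof -
    have "\<kappa> * dist y w \<le> \<kappa> * (dist y z + dist z w)"
      using \<kappa> by (intro mult_left_mono dist_triangle) auto
    then show ?thesis using that by (simp add: S_def distrib_left)
  qed
  have S_min: "\<exists>z\<in>S y. \<forall>w\<in>S y. g z \<le> g w + 1 / real (Suc k)" for y k
  proof -
    have bdd: "bdd_below (g ` S y)" using lower by (auto intro!: bdd_belowI)
    have "\<exists>z\<in>S y. g z < (INF w\<in>S y. g w) + 1 / real (Suc k)"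
      using S_refl by (intro cINF_less_iff[THEN iffD1, OF _ bdd]) auto
    moreover have "(INF w\<in>S y. g w) \<le> g w" if "w \<in> S y" for w
      using that by (intro cINF_lower bdd)
    ultimately show ?thesis
      by (meson add_right_mono less_imp_le order_trans)
  qed
  define h where "h k y = (SOME z. z \<in> S y \<and> (\<forall>w\<in>S y. g z \<le> g w + 1 / real (Suc k)))" for k y
  have "h k y \<in> S y \<and> (\<forall>w\<in>S y. g (h k y) \<le> g w + 1 / real (Suc k))" for k y
    unfolding h_def by (rule someI_ex) (use S_min in blast)
  then have h: "h k y \<in> S y" "w \<in> S y \<Longrightarrow> g (h k y) \<le> g w + 1 / real (Suc k)" for k y w
    by auto
  define Y where "Y = rec_nat x h"
  have Y0: "Y 0 = x" and YSuc: "Y (Suc k) = h k (Y k)" for k by (simp_all add: Y_def)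
  have Y_in: "Y (k + l) \<in> S (Y k)" for k l
    by (induction l) (auto simp: S_refl YSuc intro: S_trans h(1))
  have Y_dist: "\<kappa> * dist (Y k) (Y l) \<le> g (Y k) - g (Y l)" if "k \<le> l" for k l
    using Y_in[of k "l - k"] that by (simp add: S_def)
  have "decseq (\<lambda>k. g (Y k))"
  proof (rule decseq_SucI)
    fix k show "g (Y (Suc k)) \<le> g (Y k)"
      using Y_dist[of k "Suc k"] mult_nonneg_nonneg[OF less_imp_le[OF \<kappa>] zero_le_dist[of "Y k" "Y (Suc k)"]]
      by linarith
  qed
  then obtain l0 where "(\<lambda>k. g (Y k)) \<longlonglongrightarrow> l0"
    using decseq_convergent[of "\<lambda>k. g (Y k)" b] lower by blast
  then have Cauchy_g: "Cauchy (\<lambda>k. g (Y k))" by (rule LIMSEQ_imp_Cauchy)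
  have "Cauchy Y"
  proof (rule metric_CauchyI)
    fix e :: real assume "0 < e"
    then obtain N where N: "\<And>k l. k \<ge> N \<Longrightarrow> l \<ge> N \<Longrightarrow> dist (g (Y k)) (g (Y l)) < \<kappa> * e"
      using metric_CauchyD[OF Cauchy_g, of "\<kappa> * e"] \<kappa> by auto
    have "dist (Y k) (Y l) < e" if "k \<ge> N" "l \<ge> N" for k l
    proof -
      have "\<kappa> * dist (Y k) (Y l) \<le> dist (g (Y k)) (g (Y l))"
        using Y_dist[of k l] Y_dist[of l k] by (cases "k \<le> l") (auto simp: dist_real_def dist_commute)
      also have "\<dots> < \<kappa> * e" using N that by blast
      finally show ?thesis using \<kappa> by simp
    qed
    then show "\<exists>M. \<forall>m\<ge>M. \<forall>n\<ge>M. dist (Y m) (Y n) < e" by blast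
  qed
  then obtain y where y: "Y \<longlonglongrightarrow> y"
    using Cauchy_convergent_iff convergent_def by blast
  then have gy: "(\<lambda>k. g (Y k)) \<longlonglongrightarrow> g y"
    using cont continuous_on_tendsto_compose by fastforce
  have y_in: "y \<in> S (Y k)" for k
  proof -
    have "(\<lambda>l. g (Y l) + \<kappa> * dist (Y k) (Y l)) \<longlonglongrightarrow> g y + \<kappa> * dist (Y k) y"
      by (intro tendsto_intros gy y)
    moreover have "\<forall>l\<ge>k. g (Y l) + \<kappa> * dist (Y k) (Y l) \<le> g (Y k)"
      using Y_dist[of k] by (auto simp: algebra_simps)
    ultimately have "g y + \<kappa> * dist (Y k) y \<le> g (Y k)"
      by (intro LIMSEQ_le_const2) auto
    then show ?thesis by (simp add: S_def)
  qed
  have "g y - \<kappa> * dist y z \<le> g z" for z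
  proof (rule ccontr)
    assume less: "\<not> g y - \<kappa> * dist y z \<le> g z"
    then have "z \<in> S y" by (simp add: S_def)
    then have "z \<in> S (Y k)" for k using S_trans[OF y_in] by blast
    then have "g (Y (Suc k)) \<le> g z + 1 / real (Suc k)" for k
      using h(2) by (simp add: YSuc)
    moreover have "(\<lambda>k. g (Y (Suc k))) \<longlonglongrightarrow> g y" using gy by (rule LIMSEQ_Suc)
    moreover have "(\<lambda>k. g z + 1 / real (Suc k)) \<longlonglongrightarrow> g z + 0"
      by (intro tendsto_intros LIMSEQ_Suc[OF lim_1_over_n])
    ultimately have "g y \<le> g z + 0"
      by (intro LIMSEQ_le[of "\<lambda>k. g (Y (Suc k))" _ "\<lambda>k. g z + 1 / real (Suc k)"]) auto
    moreover have "0 \<le> \<kappa> * dist y z" using \<kappa> by simp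
    ultimately show False using less by linarith
  qed
  moreover have "\<kappa> * dist x y \<le> g x - g y"
    using y_in[of 0] by (simp add: S_def Y0)
  ultimately show ?thesis by blast
qed

text \<open>Ekeland's principle is applied to \<open>sqrt (F - Fmin)\<close>, whose slope off the set of minimizers is at
  least \<open>sqrt (\<mu> / 2)\<close> by the Polyak-Lojasiewicz inequality.\<close>
lemma PL_quadratic_growth:
  fixes F :: "'a::{real_inner, complete_space} \<Rightarrow> real"
  assumes smooth: "L_smooth L F" and L: "L > 0"
    and PL: "\<And>x. F x - Fmin \<le> 1 / (2 * \<mu>) * (norm (grad F x))\<^sup>2" and \<mu>: "\<mu> > 0"
    and lower: "\<And>x. Fmin \<le> F x" and c: "0 < c" "c < \<mu> / 2"
  shows "\<exists>p. F p = Fmin \<and> c * (norm (x - p))\<^sup>2 \<le> F x - Fmin"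
proof -
  define g where "g x = sqrt (F x - Fmin)" for x
  define \<kappa> where "\<kappa> = sqrt c"
  have \<kappa>: "\<kappa> > 0" "\<kappa>\<^sup>2 = c" using c by (auto simp: \<kappa>_def)
  have g_sq: "(g x)\<^sup>2 = F x - Fmin" and g_nonneg: "0 \<le> g x" for x
    using lower[of x] by (auto simp: g_def)
  have "continuous_on UNIV F"
    using smooth by (auto simp: L_smooth_def intro!: continuous_at_imp_continuous_on
        differentiable_imp_continuous_within)
  then have "continuous_on UNIV g"
    unfolding g_def by (intro continuous_intros)
  from ekeland[OF this g_nonneg \<kappa>(1)] obtain y where
    y: "\<kappa> * dist x y \<le> g x - g y" "\<And>z. g y - \<kappa> * dist y z \<le> g z"
    by blast
  have "g y = 0"
  proof (rule ccontr)
    assume "g y \<noteq> 0"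
    with g_nonneg[of y] have gy: "g y > 0" by simp
    define G where "G = norm (grad F y)"
    have G_sq: "2 * \<mu> * (g y)\<^sup>2 \<le> G\<^sup>2"
      using PL[of y] \<mu> by (simp add: g_sq G_def field_simps)
    have "(2 * \<kappa> * g y)\<^sup>2 < 2 * \<mu> * (g y)\<^sup>2"
      using c gy by (simp add: power_mult_distrib \<kappa>(2))
    with G_sq have "(2 * \<kappa> * g y)\<^sup>2 < G\<^sup>2" by linarith
    then have G: "2 * \<kappa> * g y < G"
      by (rule power_less_imp_less_base) (simp add: G_def)
    moreover have "0 < 2 * \<kappa> * g y" using \<kappa> gy by simp
    ultimately have Gpos: "G > 0" by linarith
    define t where "t = min (g y / (\<kappa> * G)) ((G - 2 * \<kappa> * g y) / (L * G))"
    have t: "0 < t" "t \<le> g y / (\<kappa> * G)" "t \<le> (G - 2 * \<kappa> * g y) / (L * G)"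
      using gy \<kappa> Gpos G L by (auto simp: t_def)
    have t1: "\<kappa> * t * G \<le> g y" and t2: "L * t * G \<le> G - 2 * \<kappa> * g y"
      using t \<kappa> Gpos L by (simp_all add: field_simps)
    define z where "z = y + (- t) *\<^sub>R grad F y"
    have "F z \<le> F y + inner ((- t) *\<^sub>R grad F y) (grad F y) + L / 2 * (norm ((- t) *\<^sub>R grad F y))\<^sup>2"
      unfolding z_def by (rule L_smooth_upper_bound[OF smooth])
    also have "\<dots> = F y - t * G\<^sup>2 + L / 2 * (t * G)\<^sup>2"
      using t(1) by (simp add: G_def power_mult_distrib flip: power2_norm_eq_inner)
    finally have Fz: "F z \<le> F y - t * G\<^sup>2 + L / 2 * (t * G)\<^sup>2" .
    have "dist y z = t * G" using t(1) by (simp add: z_def dist_norm G_def)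
    with y(2)[of z] have "g y - \<kappa> * t * G \<le> g z" by (simp add: mult.assoc)
    then have "(g y - \<kappa> * t * G)\<^sup>2 \<le> (g z)\<^sup>2"
      using t1 by (intro power_mono) auto
    moreover have "(g y - \<kappa> * t * G)\<^sup>2 \<ge> (g y)\<^sup>2 - 2 * (\<kappa> * t * G) * g y"
      by (simp add: power2_diff)
    ultimately have "F y - 2 * (\<kappa> * t * G) * g y \<le> F z" by (simp add: g_sq)
    with Fz have "t * G * G \<le> t * G * (2 * \<kappa> * g y + L * t * G / 2)"
      by (simp add: power2_eq_square algebra_simps)
    then have "G \<le> 2 * \<kappa> * g y + L * t * G / 2"
      using t(1) Gpos by (simp add: mult_le_cancel_left_pos)
    with t2 G show False by linarith
  qed
  then have "F y = Fmin" using g_sq[of y] by simp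
  moreover have "c * (norm (x - y))\<^sup>2 \<le> F x - Fmin"
  proof -
    have "(\<kappa> * norm (x - y))\<^sup>2 \<le> (g x)\<^sup>2"
      using y(1) \<open>g y = 0\<close> \<kappa> by (intro power_mono) (auto simp: dist_norm)
    then show ?thesis by (simp add: power_mult_distrib \<kappa>(2) g_sq)
  qed
  ultimately show ?thesis by blast
qed

subsection \<open>One proximal step\<close>

lemma prox_step_bound:
  fixes f :: "'a::{real_inner, complete_space} \<Rightarrow> real" and x v p :: 'a
  assumes conv: "convex_on UNIV f" and diff: "\<And>y. f differentiable (at y)" and \<alpha>: "\<alpha> > 0"
  defines "y \<equiv> prox (\<lambda>y. \<alpha> * f y) (x + \<alpha> *\<^sub>R v)"
  shows "(norm (y - p))\<^sup>2 \<le> (norm (x - p))\<^sup>2 - 2 * \<alpha> * (f x - f p)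
    + \<alpha>\<^sup>2 * (norm (grad f x - v))\<^sup>2 + 2 * \<alpha> * inner (x - p) v"
proof -
  have grad_scale: "grad (\<lambda>y. \<alpha> * f y) z = \<alpha> *\<^sub>R grad f z" for z
  proof (rule grad_eqI)
    show "GDERIV (\<lambda>y. \<alpha> * f y) z :> \<alpha> *\<^sub>R grad f z"
      using has_derivative_mult_right[OF GDERIV_grad[OF diff, of z, unfolded gderiv_def], of \<alpha>]
      by (simp add: gderiv_def)
  qed
  have "x + \<alpha> *\<^sub>R v - y = grad (\<lambda>y. \<alpha> * f y) y"
    unfolding y_def using \<alpha> diff
    by (intro prox_optimality convex_on_cmul conv differentiable_mult differentiable_const) auto
  then have y: "y - x = \<alpha> *\<^sub>R (v - grad f y)"
    by (simp add: grad_scale algebra_simps)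
  define d where "d = y - x"
  have "f y + inner (p - y) (grad f y) \<le> f p" "f x + inner (y - x) (grad f x) \<le> f y"
    by (intro convex_above_tangent conv GDERIV_grad diff)+
  then have "2 * \<alpha> * (f x + inner d (grad f x) + inner (p - y) (grad f y)) \<le> 2 * \<alpha> * f p"
    using \<alpha> by (intro mult_left_mono) (auto simp: d_def)
  moreover have "\<alpha> * inner (p - y) (grad f y) = inner (p - y) (\<alpha> *\<^sub>R v - d)"
    using y by (simp add: d_def scaleR_diff_right flip: inner_scaleR_right)
  ultimately have 1: "2 * \<alpha> * (f x - f p) + 2 * \<alpha> * inner d (grad f x) + 2 * inner (p - y) (\<alpha> *\<^sub>R v - d) \<le> 0"
    by (simp add: algebra_simps)
  have 2: "0 \<le> (norm (d - \<alpha> *\<^sub>R (v - grad f x)))\<^sup>2" by simp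
  have "(norm (d - \<alpha> *\<^sub>R (v - grad f x)))\<^sup>2 =
    inner d d - 2 * \<alpha> * inner d (v - grad f x) + \<alpha>\<^sup>2 * (norm (grad f x - v))\<^sup>2"
    unfolding norm_minus_commute[of "grad f x" v] power2_norm_eq_inner
    by (simp add: inner_commute power2_eq_square algebra_simps)
  with 2 have 3: "2 * \<alpha> * inner d (v - grad f x) - inner d d \<le> \<alpha>\<^sup>2 * (norm (grad f x - v))\<^sup>2"
    by linarith
  have 4: "(norm (y - p))\<^sup>2 = (norm (x - p))\<^sup>2 + 2 * inner d (y - p) - inner d d"
    by (simp add: d_def power2_norm_eq_inner inner_diff_left inner_diff_right inner_commute)
  have 5: "2 * inner (p - y) (\<alpha> *\<^sub>R v - d) = - 2 * \<alpha> * inner d v - 2 * \<alpha> * inner (x - p) v + 2 * inner d (y - p)"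
    by (simp add: d_def inner_diff_left inner_diff_right inner_commute algebra_simps)
  show ?thesis
    using 1 3[unfolded inner_diff_right right_diff_distrib] unfolding 4 5 by linarith
qed

locale finite_sum_PL =
  fixes f :: "nat \<Rightarrow> 'a::{real_inner, complete_space} \<Rightarrow> real" and n :: nat and L \<mu> :: real
  assumes n: "n \<ge> 1"
    and argmin: "\<exists>x. is_arg_min (average n f) (\<lambda>_. True) x"
    and convex: "\<And>j. j \<in> {1..n} \<Longrightarrow> convex_on UNIV (f j)"
    and L: "L > 0"
    and smooth: "\<And>j. j \<in> {1..n} \<Longrightarrow> L_smooth L (f j)"
    and \<mu>: "\<mu> > 0"
    and PL: "PL_condition \<mu> (average n f)"
begin

abbreviation F :: "'a \<Rightarrow> real" where "F \<equiv> average n f"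
abbreviation Fmin :: real where "Fmin \<equiv> (INF x. F x)"
abbreviation mean :: "(nat \<Rightarrow> real) \<Rightarrow> real" where "mean h \<equiv> 1 / real n * (\<Sum>j = 1..n. h j)"

lemma mean_mono: "(\<And>j. j \<in> {1..n} \<Longrightarrow> h j \<le> k j) \<Longrightarrow> mean h \<le> mean k"
  by (intro mult_left_mono sum_mono) auto

lemma mean_const: "mean (\<lambda>_. c) = c"
  using n by simp

lemma Fmin_attained: "\<exists>p. F p = Fmin \<and> (\<forall>x. F p \<le> F x)"
proof -
  obtain p where p: "\<And>x. F p \<le> F x"
    using argmin by (auto simp: is_arg_min_linorder)
  then have "Fmin = F p"
    by (intro cInf_eq_minimum) auto
  with p show ?thesis by auto
qed

lemma Fmin_le: "Fmin \<le> F x"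
  using Fmin_attained by metis

lemma GDERIV_F: "GDERIV F x :> (1 / real n) *\<^sub>R (\<Sum>j = 1..n. grad (f j) x)"
proof -
  have "(f j has_derivative (\<lambda>h. inner h (grad (f j) x))) (at x)" if "j \<in> {1..n}" for j
    using L_smooth_GDERIV[OF smooth[OF that]] by (simp add: gderiv_def)
  then have "((\<lambda>x. 1 / real n * (\<Sum>j = 1..n. f j x)) has_derivative
      (\<lambda>h. 1 / real n * (\<Sum>j = 1..n. inner h (grad (f j) x)))) (at x)"
    by (intro has_derivative_mult_right has_derivative_sum)
  then show ?thesis
    by (simp add: gderiv_def average_def[abs_def] inner_sum_right)
qed

lemma grad_F: "grad F x = (1 / real n) *\<^sub>R (\<Sum>j = 1..n. grad (f j) x)"
  by (rule grad_eqI[OF GDERIV_F])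

lemma mean_inner_grad: "mean (\<lambda>j. inner h (grad (f j) x)) = inner h (grad F x)"
  by (simp add: grad_F inner_sum_right)

lemma F_smooth: "L_smooth L F"
  unfolding L_smooth_def
proof safe
  show "F differentiable (at x)" for x
    using GDERIV_F unfolding gderiv_def by (rule differentiableI)
  fix x y
  have "norm (grad F x - grad F y) = norm ((1 / real n) *\<^sub>R (\<Sum>j = 1..n. grad (f j) x - grad (f j) y))"
    by (simp add: grad_F sum_subtractf scaleR_diff_right)
  also have "\<dots> \<le> mean (\<lambda>j. norm (grad (f j) x - grad (f j) y))"
    by (simp add: divide_right_mono norm_sum)
  also have "\<dots> \<le> mean (\<lambda>_. L * norm (x - y))"
    using smooth by (intro mean_mono) (auto simp: L_smooth_def)
  finally show "norm (grad F x - grad F y) \<le> L * norm (x - y)"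
    by (simp only: mean_const)
qed

lemma F_convex: "convex_on UNIV F"
proof -
  have "convex_on UNIV (\<lambda>x. \<Sum>j = 1..n. f j x)"
    using convex
  proof (induction n)
    case (Suc n)
    then have "convex_on UNIV (\<lambda>x. (\<Sum>j = 1..n. f j x) + f (Suc n) x)"
      by (intro convex_on_add) auto
    then show ?case by simp
  qed (simp add: convex_on_const)
  then have "convex_on UNIV (\<lambda>x. 1 / real n * (\<Sum>j = 1..n. f j x))"
    by (intro convex_on_cmul) auto
  then show ?thesis by (simp only: average_def[abs_def])
qed

lemma grad_F_minimizer: "F p = Fmin \<Longrightarrow> grad F p = 0"
  using F_smooth Fmin_le by (intro grad_minimizer) (auto simp: L_smooth_def)

lemma PL_F: "2 * \<mu> * (F x - Fmin) \<le> (norm (grad F x))\<^sup>2"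
  using PL \<mu> by (simp add: PL_condition_def field_simps)

lemma quadratic_growth:
  assumes "0 < c" "c < \<mu> / 2"
  shows "\<exists>p. F p = Fmin \<and> c * (norm (x - p))\<^sup>2 \<le> F x - Fmin"
  using PL by (intro PL_quadratic_growth[OF F_smooth L _ \<mu> Fmin_le assms])
    (auto simp: PL_condition_def)

lemma \<mu>_le_L:
  assumes "F x \<noteq> Fmin"
  shows "\<mu> \<le> L"
proof -
  obtain p where p: "F p = Fmin" using Fmin_attained by blast
  have "(norm (grad F x - grad F p))\<^sup>2 \<le> 2 * L * (F x - F p - inner (x - p) (grad F p))"
    by (rule grad_cocoercive[OF F_convex F_smooth L])
  then have "(norm (grad F x))\<^sup>2 \<le> 2 * L * (F x - Fmin)"
    by (simp add: grad_F_minimizer[OF p] p)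
  with PL_F[of x] have "\<mu> * (F x - Fmin) \<le> L * (F x - Fmin)" by simp
  moreover have "0 < F x - Fmin" using Fmin_le[of x] assms by simp
  ultimately show ?thesis by simp
qed

lemma grad_variance:
  assumes p: "F p = Fmin"
  shows "mean (\<lambda>j. (norm (grad (f j) x - grad (f j) p))\<^sup>2) \<le> 2 * L * (F x - Fmin)"
proof -
  have "mean (\<lambda>j. (norm (grad (f j) x - grad (f j) p))\<^sup>2)
      \<le> mean (\<lambda>j. 2 * L * (f j x - f j p - inner (x - p) (grad (f j) p)))"
    by (intro mean_mono grad_cocoercive convex smooth L)
  also have "\<dots> = 2 * L * (F x - F p - mean (\<lambda>j. inner (x - p) (grad (f j) p)))"
    by (simp add: average_def sum_subtractf right_diff_distrib sum_distrib_left[symmetric]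
        diff_divide_distrib flip: sum_distrib_left)
  finally show ?thesis
    by (simp only: mean_inner_grad) (simp add: grad_F_minimizer[OF p] p)
qed

lemma estimator_second_moment:
  assumes p: "F p = Fmin"
  shows "mean (\<lambda>j. (norm (grad (f j) x - (grad (f j) z - grad F z)))\<^sup>2)
    \<le> 4 * L * (F x - Fmin) + 4 * (L - \<mu>) * (F z - Fmin)"
proof -
  define a where "a j = grad (f j) x - grad (f j) p" for j
  define b where "b j = grad (f j) z - grad (f j) p" for j
  have cancel: "u - 2 * w + w = u - w" for u w :: real by simp
  have mean_b: "mean (\<lambda>j. inner (grad F z) (b j)) = inner (grad F z) (grad F z)"
    by (simp only: b_def inner_diff_right sum_subtractf right_diff_distrib mean_inner_grad
        grad_F_minimizer[OF p] inner_zero_right diff_zero)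
  have "(norm (grad (f j) x - (grad (f j) z - grad F z)))\<^sup>2
      \<le> 2 * (norm (a j))\<^sup>2 + 2 * ((norm (b j))\<^sup>2 - 2 * inner (grad F z) (b j) + inner (grad F z) (grad F z))" for j
  proof -
    have "0 \<le> (norm (a j + (b j - grad F z)))\<^sup>2" by simp
    moreover have "grad (f j) x - (grad (f j) z - grad F z) = a j - (b j - grad F z)"
      by (simp add: a_def b_def)
    ultimately show ?thesis
      by (simp only: power2_norm_eq_inner) (simp add: inner_diff_left inner_diff_right inner_add_left
          inner_add_right inner_commute)
  qed
  then have "mean (\<lambda>j. (norm (grad (f j) x - (grad (f j) z - grad F z)))\<^sup>2) \<le> mean (\<lambda>j.
      2 * (norm (a j))\<^sup>2 + 2 * ((norm (b j))\<^sup>2 - 2 * inner (grad F z) (b j) + inner (grad F z) (grad F z)))"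
    by (intro mean_mono)
  also have "\<dots> = 2 * mean (\<lambda>j. (norm (a j))\<^sup>2) + 2 * (mean (\<lambda>j. (norm (b j))\<^sup>2)
      - 2 * mean (\<lambda>j. inner (grad F z) (b j)) + mean (\<lambda>_. inner (grad F z) (grad F z)))"
    by (simp only: sum.distrib sum_subtractf sum_distrib_left[symmetric] distrib_left
        right_diff_distrib mult.left_commute[of "1 / real n"])
  also have "\<dots> = 2 * mean (\<lambda>j. (norm (a j))\<^sup>2) + 2 * (mean (\<lambda>j. (norm (b j))\<^sup>2) - (norm (grad F z))\<^sup>2)"
    by (simp only: mean_b mean_const power2_norm_eq_inner cancel)
  also have "\<dots> \<le> 2 * (2 * L * (F x - Fmin)) + 2 * (2 * L * (F z - Fmin) - 2 * \<mu> * (F z - Fmin))"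
    unfolding a_def b_def
    by (intro add_mono mult_left_mono diff_mono grad_variance[OF p] PL_F) auto
  finally show ?thesis by (simp add: algebra_simps)
qed

lemma svrp_step_bound:
  assumes p: "F p = Fmin" and \<alpha>: "\<alpha> > 0"
  shows "mean (\<lambda>j. (norm (prox (\<lambda>y. \<alpha> * f j y) (x + \<alpha> *\<^sub>R grad (f j) z - \<alpha> *\<^sub>R grad F z) - p))\<^sup>2)
    \<le> (norm (x - p))\<^sup>2 - 2 * \<alpha> * (1 - 2 * L * \<alpha>) * (F x - Fmin) + 4 * \<alpha>\<^sup>2 * (L - \<mu>) * (F z - Fmin)"
proof -
  define v where "v j = grad (f j) z - grad F z" for j
  have shift: "x + \<alpha> *\<^sub>R grad (f j) z - \<alpha> *\<^sub>R grad F z = x + \<alpha> *\<^sub>R v j" for j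
    by (simp add: v_def algebra_simps)
  have "mean (\<lambda>j. (norm (prox (\<lambda>y. \<alpha> * f j y) (x + \<alpha> *\<^sub>R v j) - p))\<^sup>2) \<le>
      mean (\<lambda>j. (norm (x - p))\<^sup>2 - 2 * \<alpha> * (f j x - f j p)
        + \<alpha>\<^sup>2 * (norm (grad (f j) x - v j))\<^sup>2 + 2 * \<alpha> * inner (x - p) (v j))"
    using smooth by (intro mean_mono prox_step_bound convex \<alpha>) (auto simp: L_smooth_def)
  also have "\<dots> = mean (\<lambda>_. (norm (x - p))\<^sup>2) - 2 * \<alpha> * (mean (\<lambda>j. f j x) - mean (\<lambda>j. f j p))
      + \<alpha>\<^sup>2 * mean (\<lambda>j. (norm (grad (f j) x - v j))\<^sup>2) + 2 * \<alpha> * mean (\<lambda>j. inner (x - p) (v j))"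
    by (simp only: sum.distrib sum_subtractf sum_distrib_left[symmetric] distrib_left
        right_diff_distrib mult.left_commute[of "1 / real n"])
  also have "mean (\<lambda>j. inner (x - p) (v j)) = 0"
    by (simp only: v_def inner_diff_right sum_subtractf right_diff_distrib mean_inner_grad mean_const
        diff_self)
  also have "mean (\<lambda>_. (norm (x - p))\<^sup>2) = (norm (x - p))\<^sup>2" by (rule mean_const)
  also have "mean (\<lambda>j. f j x) - mean (\<lambda>j. f j p) = F x - Fmin"
    by (simp only: p[symmetric]) (simp only: average_def)
  also have "(norm (x - p))\<^sup>2 - 2 * \<alpha> * (F x - Fmin) + \<alpha>\<^sup>2 * mean (\<lambda>j. (norm (grad (f j) x - v j))\<^sup>2) + 2 * \<alpha> * 0
      \<le> (norm (x - p))\<^sup>2 - 2 * \<alpha> * (F x - Fmin)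
        + \<alpha>\<^sup>2 * (4 * L * (F x - Fmin) + 4 * (L - \<mu>) * (F z - Fmin)) + 2 * \<alpha> * 0"
    unfolding v_def by (intro add_mono mult_left_mono estimator_second_moment[OF p] order_refl)
      (use \<alpha> in auto)
  also have "\<dots> = (norm (x - p))\<^sup>2 - 2 * \<alpha> * (1 - 2 * L * \<alpha>) * (F x - Fmin) + 4 * \<alpha>\<^sup>2 * (L - \<mu>) * (F z - Fmin)"
    by (simp add: algebra_simps power2_eq_square)
  finally show ?thesis by (simp only: shift)
qed

end

subsection \<open>Functions of finitely many independent discrete variables\<close>

definition depends_on :: "(('i \<Rightarrow> 'v) \<Rightarrow> 'b) \<Rightarrow> 'i set \<Rightarrow> bool"
  where "depends_on H J \<longleftrightarrow> (\<forall>g h. (\<forall>k\<in>J. g k = h k) \<longrightarrow> H g = H h)"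

lemma depends_onD: "depends_on H J \<Longrightarrow> (\<And>k. k \<in> J \<Longrightarrow> g k = h k) \<Longrightarrow> H g = H h"
  by (auto simp: depends_on_def)

lemma depends_on_fun_upd:
  assumes "depends_on H (insert c J)"
  shows "depends_on (\<lambda>g. H (g(c := a))) J"
  unfolding depends_on_def by (intro allI impI depends_onD[OF assms]) auto

context prob_space
begin

lemma measurable_restrict_count_space:
  fixes Z :: "'i \<Rightarrow> 'a \<Rightarrow> 'v::countable"
  assumes "finite J" "\<And>k. k \<in> J \<Longrightarrow> random_variable (count_space UNIV) (Z k)"
  shows "(\<lambda>\<omega>. restrict (\<lambda>k. Z k \<omega>) J) \<in> measurable M (count_space (PiE J (\<lambda>_. UNIV)))"
  using assms by (subst count_space_PiM_finite[symmetric]) (auto intro!: measurable_restrict)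

lemma measurable_depends_on:
  fixes Z :: "'i \<Rightarrow> 'a \<Rightarrow> 'v::countable" and H :: "('i \<Rightarrow> 'v) \<Rightarrow> 'c::topological_space"
  assumes J: "finite J" and rv: "\<And>k. k \<in> J \<Longrightarrow> random_variable (count_space UNIV) (Z k)"
    and H: "depends_on H J"
  shows "(\<lambda>\<omega>. H (\<lambda>k. Z k \<omega>)) \<in> borel_measurable M"
proof -
  have "(\<lambda>\<omega>. H (restrict (\<lambda>k. Z k \<omega>) J)) \<in> borel_measurable M"
    by (rule measurable_compose[OF measurable_restrict_count_space[OF J rv]]) auto
  also have "(\<lambda>\<omega>. H (restrict (\<lambda>k. Z k \<omega>) J)) = (\<lambda>\<omega>. H (\<lambda>k. Z k \<omega>))"
    by (intro ext depends_onD[OF H]) auto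
  finally show ?thesis .
qed

lemma integrable_depends_on:
  fixes Z :: "'i \<Rightarrow> 'a \<Rightarrow> 'v::countable" and H :: "('i \<Rightarrow> 'v) \<Rightarrow> real"
  assumes J: "finite J" and rv: "\<And>k. k \<in> J \<Longrightarrow> random_variable (count_space UNIV) (Z k)"
    and range: "\<And>k. k \<in> J \<Longrightarrow> finite (A k)" "\<And>k. k \<in> J \<Longrightarrow> AE \<omega> in M. Z k \<omega> \<in> A k"
    and H: "depends_on H J"
  shows "integrable M (\<lambda>\<omega>. H (\<lambda>k. Z k \<omega>))"
proof (rule integrable_const_bound)
  have fin: "finite (PiE J A)" using J range by (intro finite_PiE) auto
  have "AE \<omega> in M. \<forall>k\<in>J. Z k \<omega> \<in> A k"
    using J range by (simp add: AE_finite_all)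
  then show "AE \<omega> in M. norm (H (\<lambda>k. Z k \<omega>)) \<le> (\<Sum>g\<in>PiE J A. norm (H g))"
  proof eventually_elim
    case (elim \<omega>)
    have "H (\<lambda>k. Z k \<omega>) = H (restrict (\<lambda>k. Z k \<omega>) J)"
      by (intro depends_onD[OF H]) auto
    moreover have "restrict (\<lambda>k. Z k \<omega>) J \<in> PiE J A" using elim by auto
    ultimately show ?case
      using member_le_sum[OF _ _ fin, of "restrict (\<lambda>k. Z k \<omega>) J" "\<lambda>g. norm (H g)"] by simp
  qed
qed (rule measurable_depends_on[OF J rv H])

lemma AE_uniform:
  assumes X: "random_variable (count_space UNIV) X"
    and unif: "distr M (count_space UNIV) X = measure_pmf (pmf_of_set A)" and A: "finite A" "A \<noteq> {}"
  shows "AE \<omega> in M. X \<omega> \<in> A"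
proof -
  have "AE x in distr M (count_space UNIV) X. x \<in> A"
    unfolding unif using A by (simp add: AE_measure_pmf_iff)
  then show ?thesis
    using X by (simp add: AE_distr_iff)
qed

lemma expectation_uniform_coordinate:
  fixes Z :: "'i \<Rightarrow> 'a \<Rightarrow> 'v::countable" and H :: "('i \<Rightarrow> 'v) \<Rightarrow> real"
  assumes indep: "indep_vars (\<lambda>_. count_space UNIV) Z UNIV"
    and range: "\<And>k. finite (A k)" "\<And>k. A k \<noteq> {}"
    and unif: "\<And>k. distr M (count_space UNIV) (Z k) = measure_pmf (pmf_of_set (A k))"
    and J: "finite J" "c \<notin> J" and H: "depends_on H (insert c J)"
  shows "expectation (\<lambda>\<omega>. H (\<lambda>k. Z k \<omega>))
    = 1 / real (card (A c)) * (\<Sum>a\<in>A c. expectation (\<lambda>\<omega>. H ((\<lambda>k. Z k \<omega>)(c := a))))"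
proof -
  have rv: "random_variable (count_space UNIV) (Z k)" for k
    using indep by (simp add: indep_vars_def2)
  note AE_Z = AE_uniform[OF rv unif range]
  define G where "G a g = H (g(c := a))" for a g
  have G: "depends_on (G a) J" for a
    unfolding G_def[abs_def] by (rule depends_on_fun_upd[OF H])
  have int_G: "integrable M (\<lambda>\<omega>. G a (\<lambda>k. Z k \<omega>))" for a
    by (rule integrable_depends_on[OF J(1) rv range(1) AE_Z G])
  define I where "I a \<omega> = (indicator {a} (Z c \<omega>) :: real)" for a \<omega>
  have int_I: "integrable M (I a)" for a
    unfolding I_def by (intro integrable_const_bound[of _ 1] AE_I2 measurable_compose[OF rv]) auto
  have exp_I: "expectation (I a) = 1 / real (card (A c))" if "a \<in> A c" for a
  proof -
    have "expectation (I a) = (\<integral>x. indicator {a} x \<partial>distr M (count_space UNIV) (Z c))"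
      unfolding I_def by (rule integral_distr[OF rv, symmetric]) auto
    also have "\<dots> = pmf (pmf_of_set (A c)) a"
      unfolding unif by (simp add: measure_pmf_single)
    finally show ?thesis using that range by simp
  qed
  have indep_IG: "indep_var borel (I a) borel (\<lambda>\<omega>. G a (\<lambda>k. Z k \<omega>))" for a
  proof -
    have "indep_var (PiM {c} (\<lambda>_. count_space UNIV)) (\<lambda>\<omega>. restrict (\<lambda>k. Z k \<omega>) {c})
        (PiM J (\<lambda>_. count_space UNIV)) (\<lambda>\<omega>. restrict (\<lambda>k. Z k \<omega>) J)"
      using J by (intro indep_var_restrict[OF indep]) auto
    then have "indep_var borel ((\<lambda>g. indicator {a} (g c)) \<circ> (\<lambda>\<omega>. restrict (\<lambda>k. Z k \<omega>) {c}))
        borel (G a \<circ> (\<lambda>\<omega>. restrict (\<lambda>k. Z k \<omega>) J))"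
      using J by (intro indep_var_compose) (auto simp: count_space_PiM_finite)
    moreover have "(\<lambda>g. indicator {a} (g c)) \<circ> (\<lambda>\<omega>. restrict (\<lambda>k. Z k \<omega>) {c}) = I a"
      by (auto simp: I_def)
    moreover have "G a \<circ> (\<lambda>\<omega>. restrict (\<lambda>k. Z k \<omega>) J) = (\<lambda>\<omega>. G a (\<lambda>k. Z k \<omega>))"
      unfolding o_def by (intro ext depends_onD[OF G]) auto
    ultimately show ?thesis by simp
  qed
  have int_IG: "integrable M (\<lambda>\<omega>. I a \<omega> * G a (\<lambda>k. Z k \<omega>))" for a
    by (rule indep_var_integrable[OF indep_IG int_I int_G])
  have "expectation (\<lambda>\<omega>. H (\<lambda>k. Z k \<omega>)) = expectation (\<lambda>\<omega>. \<Sum>a\<in>A c. I a \<omega> * G a (\<lambda>k. Z k \<omega>))"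
  proof (rule integral_cong_AE)
    show "(\<lambda>\<omega>. H (\<lambda>k. Z k \<omega>)) \<in> borel_measurable M"
      using J by (intro measurable_depends_on[OF _ rv H]) auto
    show "(\<lambda>\<omega>. \<Sum>a\<in>A c. I a \<omega> * G a (\<lambda>k. Z k \<omega>)) \<in> borel_measurable M"
      using int_IG by (intro borel_measurable_sum borel_measurable_integrable)
    show "AE \<omega> in M. H (\<lambda>k. Z k \<omega>) = (\<Sum>a\<in>A c. I a \<omega> * G a (\<lambda>k. Z k \<omega>))"
      using AE_Z[of c]
    proof eventually_elim
      case (elim \<omega>)
      have "(\<Sum>a\<in>A c. I a \<omega> * G a (\<lambda>k. Z k \<omega>)) = (\<Sum>a\<in>A c. if Z c \<omega> = a then G a (\<lambda>k. Z k \<omega>) else 0)"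
        by (intro sum.cong) (auto simp: I_def)
      also have "\<dots> = G (Z c \<omega>) (\<lambda>k. Z k \<omega>)"
        using elim range by simp
      also have "\<dots> = H (\<lambda>k. Z k \<omega>)"
        unfolding G_def by (rule arg_cong[of _ _ H]) auto
      finally show ?case by simp
    qed
  qed
  also have "\<dots> = (\<Sum>a\<in>A c. expectation (\<lambda>\<omega>. I a \<omega> * G a (\<lambda>k. Z k \<omega>)))"
    by (rule Bochner_Integration.integral_sum[OF int_IG])
  also have "\<dots> = (\<Sum>a\<in>A c. 1 / real (card (A c)) * expectation (\<lambda>\<omega>. G a (\<lambda>k. Z k \<omega>)))"
    by (intro sum.cong refl) (simp only: indep_var_lebesgue_integral[OF indep_IG int_I int_G] exp_I)
  finally show ?thesis by (simp only: sum_distrib_left G_def)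
qed

lemma indep_vars_case_sum:
  assumes X: "indep_vars (\<lambda>_. N) X UNIV" and Y: "indep_vars (\<lambda>_. N) Y UNIV"
    and XY: "indep_var (PiM UNIV (\<lambda>_. N)) (\<lambda>\<omega> k. X k \<omega>) (PiM UNIV (\<lambda>_. N)) (\<lambda>\<omega> k. Y k \<omega>)"
  shows "indep_vars (\<lambda>_. N) (case_sum X Y) UNIV"
  unfolding indep_vars_def2
proof (intro conjI ballI indep_setsI)
  have rvX: "random_variable N (X k)" for k using X by (simp add: indep_vars_def2)
  have rvY: "random_variable N (Y k)" for k using Y by (simp add: indep_vars_def2)
  show rv: "random_variable N (case_sum X Y k)" for k
    using rvX rvY by (cases k) auto
  then show "{case_sum X Y k -` B \<inter> space M |B. B \<in> sets N} \<subseteq> events" for k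
    by auto
  fix A J assume J: "J \<noteq> {}" "finite J"
    and "\<forall>j\<in>J. A j \<in> {case_sum X Y j -` B \<inter> space M |B. B \<in> sets N}"
  then have "\<forall>j\<in>J. \<exists>B. A j = case_sum X Y j -` B \<inter> space M \<and> B \<in> sets N"
    by auto
  then obtain B where A: "\<And>j. j \<in> J \<Longrightarrow> A j = case_sum X Y j -` B j \<inter> space M"
    and B: "\<And>j. j \<in> J \<Longrightarrow> B j \<in> sets N"
    by metis
  define J1 where "J1 = Inl -` J"
  define J2 where "J2 = Inr -` J"
  have J12: "J = Inl ` J1 \<union> Inr ` J2"
    unfolding J1_def J2_def by (auto simp: image_iff) (metis sumE)
  have fin: "finite J1" "finite J2"
    using J by (auto simp: J1_def J2_def intro!: finite_vimageI)
  have marginal: "prob {\<omega> \<in> space M. \<forall>k\<in>K. W k \<omega> \<in> C k} = (\<Prod>k\<in>K. prob (W k -` C k \<inter> space M))"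
    if "indep_vars (\<lambda>_. N) W UNIV" "finite K" "\<And>k. k \<in> K \<Longrightarrow> C k \<in> sets N" for W K C
  proof (cases "K = {}")
    case False
    then have "{\<omega> \<in> space M. \<forall>k\<in>K. W k \<omega> \<in> C k} = (\<Inter>k\<in>K. W k -` C k \<inter> space M)"
      by auto
    then show ?thesis using indep_varsD[OF that(1) False that(2)] that(3) by simp
  qed (simp add: prob_space)
  define E1 where "E1 = {g \<in> space (PiM UNIV (\<lambda>_. N)). \<forall>k\<in>J1. g k \<in> B (Inl k)}"
  define E2 where "E2 = {g \<in> space (PiM UNIV (\<lambda>_. N)). \<forall>k\<in>J2. g k \<in> B (Inr k)}"
  have E: "E1 \<in> sets (PiM UNIV (\<lambda>_. N))" "E2 \<in> sets (PiM UNIV (\<lambda>_. N))"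
    unfolding E1_def E2_def using fin B
    by (auto simp: J1_def J2_def intro!: sets.sets_Collect_finite_All' measurable_sets_Collect
        intro: sets_Collect_single)
  have INT_eq: "(\<Inter>j\<in>J. A j) = {\<omega> \<in> space M. \<forall>j\<in>J. case_sum X Y j \<omega> \<in> B j}"
    using J(1) by (auto simp: A)
  have "(\<Inter>j\<in>J. A j) = (\<lambda>\<omega>. (\<lambda>k. X k \<omega>, \<lambda>k. Y k \<omega>)) -` (E1 \<times> E2) \<inter> space M"
    unfolding INT_eq using measurable_space[OF rvX] measurable_space[OF rvY]
    by (auto simp: E1_def E2_def J12 ball_Un space_PiM)
  then have "prob (\<Inter>j\<in>J. A j)
      = prob ((\<lambda>\<omega> k. X k \<omega>) -` E1 \<inter> space M) * prob ((\<lambda>\<omega> k. Y k \<omega>) -` E2 \<inter> space M)"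
    using indep_varD[OF XY E] by simp
  also have "(\<lambda>\<omega> k. X k \<omega>) -` E1 \<inter> space M = {\<omega> \<in> space M. \<forall>k\<in>J1. X k \<omega> \<in> B (Inl k)}"
    using measurable_space[OF rvX] by (auto simp: E1_def space_PiM)
  also have "(\<lambda>\<omega> k. Y k \<omega>) -` E2 \<inter> space M = {\<omega> \<in> space M. \<forall>k\<in>J2. Y k \<omega> \<in> B (Inr k)}"
    using measurable_space[OF rvY] by (auto simp: E2_def space_PiM)
  also have "prob {\<omega> \<in> space M. \<forall>k\<in>J1. X k \<omega> \<in> B (Inl k)} * prob {\<omega> \<in> space M. \<forall>k\<in>J2. Y k \<omega> \<in> B (Inr k)}
      = (\<Prod>k\<in>J1. prob (A (Inl k))) * (\<Prod>k\<in>J2. prob (A (Inr k)))"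
  proof -
    have B12: "B (Inl k) \<in> sets N" "A (Inl k) = X k -` B (Inl k) \<inter> space M" if "k \<in> J1" for k
      using that A B by (auto simp: J1_def)
    have B22: "B (Inr k) \<in> sets N" "A (Inr k) = Y k -` B (Inr k) \<inter> space M" if "k \<in> J2" for k
      using that A B by (auto simp: J2_def)
    show ?thesis
      using marginal[OF X fin(1) B12(1)] marginal[OF Y fin(2) B22(1)] by (simp add: B12 B22)
  qed
  also have "\<dots> = (\<Prod>j\<in>J. prob (A j))"
    unfolding J12 using fin by (subst prod.union_disjoint) (auto simp: prod.reindex)
  finally show "prob (\<Inter>j\<in>J. A j) = (\<Prod>j\<in>J. prob (A j))" .
qed

end

subsection \<open>The stochastic process\<close>

lemma svrp_inner_cong:
  assumes "\<And>t. t < s * m + k \<Longrightarrow> idx t = idx' t"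
  shows "svrp_inner \<alpha> m n f idx s xt k = svrp_inner \<alpha> m n f idx' s xt k"
  using assms by (induction k) auto

lemma svrp_cong:
  assumes "\<And>t. t < s \<Longrightarrow> \<xi> t = \<xi>' t" "\<And>t. t < s * m \<Longrightarrow> idx t = idx' t"
  shows "svrp upd \<alpha> m n f x0 \<xi> idx s = svrp upd \<alpha> m n f x0 \<xi>' idx' s"
  using assms
proof (induction s)
  case (Suc s)
  then have "svrp upd \<alpha> m n f x0 \<xi> idx s = svrp upd \<alpha> m n f x0 \<xi>' idx' s"
    by simp
  moreover have "svrp_inner \<alpha> m n f idx s xt k = svrp_inner \<alpha> m n f idx' s xt k" if "k < m" for xt k
    using that Suc.prems by (intro svrp_inner_cong) auto
  ultimately show ?case
    using Suc.prems(1)[of s] by (cases upd) (simp_all add: Let_def)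
qed simp

locale svrp_process = finite_sum_PL f n L \<mu> + prob_space M
  for f :: "nat \<Rightarrow> 'a::{real_inner, complete_space} \<Rightarrow> real" and n L \<mu> and M :: "'w measure" +
  fixes m :: nat and \<alpha> :: real and x0 :: 'a and \<xi> i :: "nat \<Rightarrow> 'w \<Rightarrow> nat" and upd :: svrp_update
  assumes xi_indep: "indep_vars (\<lambda>_. count_space UNIV) \<xi> UNIV"
    and xi_unif: "\<And>s. distr M (count_space UNIV) (\<xi> s) = measure_pmf (pmf_of_set {0..<m})"
    and i_indep: "indep_vars (\<lambda>_. count_space UNIV) i UNIV"
    and i_unif: "\<And>t. distr M (count_space UNIV) (i t) = measure_pmf (pmf_of_set {1..n})"
    and xi_i_indep: "indep_var (PiM UNIV (\<lambda>_. count_space UNIV)) (\<lambda>\<omega> s. \<xi> s \<omega>)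
      (PiM UNIV (\<lambda>_. count_space UNIV)) (\<lambda>\<omega> t. i t \<omega>)"
    and m: "m \<ge> 1" and \<alpha>: "\<alpha> > 0"
begin

text \<open>All randomness is collected in one independent family indexed by \<open>nat + nat\<close>: \<open>Inl s\<close> is the
  coordinate of \<open>\<xi> s\<close> and \<open>Inr t\<close> that of \<open>i t\<close>. The iterates are functions of a sample path
  of this family.\<close>
definition noise :: "'w \<Rightarrow> nat + nat \<Rightarrow> nat" where "noise \<omega> k = case_sum \<xi> i k \<omega>"

definition outer :: "nat \<Rightarrow> (nat + nat \<Rightarrow> nat) \<Rightarrow> 'a"
  where "outer s g = svrp upd \<alpha> m n f x0 (\<lambda>t. g (Inl t)) (\<lambda>t. g (Inr t)) s"

definition inner_iter :: "nat \<Rightarrow> nat \<Rightarrow> (nat + nat \<Rightarrow> nat) \<Rightarrow> 'a"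
  where "inner_iter s k g = svrp_inner \<alpha> m n f (\<lambda>t. g (Inr t)) s (outer s g) k"

definition coords :: "nat \<Rightarrow> nat \<Rightarrow> (nat + nat) set"
  where "coords s k = Inl ` {..<s} \<union> Inr ` {..<s * m + k}"

lemma finite_coords: "finite (coords s k)"
  by (simp add: coords_def)

lemma coords_Suc: "coords s (Suc k) = insert (Inr (s * m + k)) (coords s k)"
  by (auto simp: coords_def lessThan_Suc)

lemma coords_Suc_0: "coords (Suc s) 0 = insert (Inl s) (coords s m)"
  by (auto simp: coords_def lessThan_Suc add.commute)

lemma outer_cong: "(\<And>k. k \<in> coords s l \<Longrightarrow> g k = h k) \<Longrightarrow> outer s g = outer s h"
  unfolding outer_def by (intro svrp_cong) (auto simp: coords_def)

lemma inner_iter_cong: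
  "(\<And>j. j \<in> coords s l \<Longrightarrow> g j = h j) \<Longrightarrow> k \<le> l \<Longrightarrow> inner_iter s k g = inner_iter s k h"
  unfolding inner_iter_def
  by (subst outer_cong[of s l g h]) (auto intro!: svrp_inner_cong simp: coords_def)

lemma depends_on_iterates:
  "depends_on (\<lambda>g. H (inner_iter s k g) (outer s g)) (coords s k)"
  unfolding depends_on_def
proof (intro allI impI)
  fix g h :: "nat + nat \<Rightarrow> nat"
  assume "\<forall>j\<in>coords s k. g j = h j"
  then have "inner_iter s k g = inner_iter s k h" "outer s g = outer s h"
    by (auto intro: inner_iter_cong[of s k] outer_cong[of s k])
  then show "H (inner_iter s k g) (outer s g) = H (inner_iter s k h) (outer s h)"
    by simp
qed

lemma inner_iter_0: "inner_iter s 0 = outer s"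
  by (simp add: inner_iter_def fun_eq_iff)

lemma inner_iter_Suc_upd:
  "inner_iter s (Suc k) (g(Inr (s * m + k) := j))
    = prox (\<lambda>y. \<alpha> * f j y) (inner_iter s k g + \<alpha> *\<^sub>R grad (f j) (outer s g) - \<alpha> *\<^sub>R grad F (outer s g))"
  (is "inner_iter s _ ?g = _")
proof -
  have "outer s ?g = outer s g" by (rule outer_cong[of s k]) (auto simp: coords_def)
  moreover have "inner_iter s k ?g = inner_iter s k g"
    by (rule inner_iter_cong[of s k]) (auto simp: coords_def)
  ultimately show ?thesis by (simp add: inner_iter_def)
qed

lemma outer_Suc_average:
  assumes "upd = Average_Iterate"
  shows "outer (Suc s) g = (1 / real m) *\<^sub>R (\<Sum>k<m. inner_iter s k g)"
  unfolding outer_def inner_iter_def by (simp add: assms Let_def)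

lemma outer_Suc_random_upd:
  assumes "upd = Random_Iterate" "k < m"
  shows "outer (Suc s) (g(Inl s := k)) = inner_iter s k g"
proof -
  let ?g = "g(Inl s := k)"
  have "outer (Suc s) ?g = (\<Sum>l<m. (if l = k then 1 else 0) *\<^sub>R inner_iter s l ?g)"
    unfolding outer_def inner_iter_def by (simp add: assms(1) Let_def)
  also have "\<dots> = (\<Sum>l<m. if k = l then inner_iter s l ?g else 0)"
    by (intro sum.cong) auto
  also have "\<dots> = inner_iter s k ?g"
    using assms(2) by simp
  also have "\<dots> = inner_iter s k g"
    by (rule inner_iter_cong[of s k]) (auto simp: coords_def)
  finally show ?thesis .
qed

lemma noise_indep: "indep_vars (\<lambda>_. count_space UNIV) (case_sum \<xi> i) UNIV"
  by (rule indep_vars_case_sum[OF xi_indep i_indep xi_i_indep])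

definition noise_range :: "nat + nat \<Rightarrow> nat set"
  where "noise_range = case_sum (\<lambda>_. {0..<m}) (\<lambda>_. {1..n})"

lemma noise_range: "finite (noise_range k)" "noise_range k \<noteq> {}"
  using m n by (auto simp: noise_range_def split: sum.split)

lemma noise_unif:
  "distr M (count_space UNIV) (case_sum \<xi> i k) = measure_pmf (pmf_of_set (noise_range k))"
  using xi_unif i_unif by (cases k) (auto simp: noise_range_def)

lemma integrable_noise:
  fixes H :: "(nat + nat \<Rightarrow> nat) \<Rightarrow> real"
  assumes "depends_on H (coords s k)"
  shows "integrable M (\<lambda>\<omega>. H (noise \<omega>))"
proof -
  have rv: "random_variable (count_space UNIV) (case_sum \<xi> i k)" for k
    using noise_indep by (simp add: indep_vars_def2)
  show ?thesis
    unfolding noise_def[abs_def]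
    by (rule integrable_depends_on[OF finite_coords rv noise_range(1)
          AE_uniform[OF rv noise_unif noise_range] assms])
qed

lemma expectation_noise:
  fixes H :: "(nat + nat \<Rightarrow> nat) \<Rightarrow> real"
  assumes "c \<notin> coords s k" "depends_on H (insert c (coords s k))"
  shows "expectation (\<lambda>\<omega>. H (noise \<omega>)) = 1 / real (card (noise_range c)) *
    (\<Sum>a\<in>noise_range c. expectation (\<lambda>\<omega>. H ((noise \<omega>)(c := a))))"
  unfolding noise_def[abs_def]
  by (rule expectation_uniform_coordinate[OF noise_indep noise_range noise_unif finite_coords assms])

definition outer_gap :: "nat \<Rightarrow> real"
  where "outer_gap s = expectation (\<lambda>\<omega>. F (outer s (noise \<omega>)) - Fmin)"

definition inner_gap :: "nat \<Rightarrow> nat \<Rightarrow> real"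
  where "inner_gap s k = expectation (\<lambda>\<omega>. F (inner_iter s k (noise \<omega>)) - Fmin)"

lemma integrable_inner_gap: "integrable M (\<lambda>\<omega>. F (inner_iter s k (noise \<omega>)) - Fmin)"
  using integrable_noise[OF depends_on_iterates[of "\<lambda>x _. F x - Fmin"]] .

lemma integrable_outer_gap: "integrable M (\<lambda>\<omega>. F (outer s (noise \<omega>)) - Fmin)"
  using integrable_inner_gap[of s 0] by (simp add: inner_iter_0)

lemma inner_distance_step:
  fixes p :: "'a \<Rightarrow> 'a" and s :: nat
  assumes p: "\<And>x. F (p x) = Fmin"
  defines "D k \<equiv> expectation (\<lambda>\<omega>. (norm (inner_iter s k (noise \<omega>) - p (outer s (noise \<omega>))))\<^sup>2)"
  shows "D (Suc k) \<le> D k - 2 * \<alpha> * (1 - 2 * L * \<alpha>) * inner_gap s k + 4 * \<alpha>\<^sup>2 * (L - \<mu>) * outer_gap s"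
proof -
  define d where "d k g = (norm (inner_iter s k g - p (outer s g)))\<^sup>2" for k g
  have d: "depends_on (d k) (coords s k)" for k
    unfolding d_def by (rule depends_on_iterates)
  let ?c = "Inr (s * m + k) :: nat + nat"
  have c: "?c \<notin> coords s k" by (auto simp: coords_def)
  have c_range: "noise_range ?c = {1..n}" by (simp add: noise_range_def)
  have d_Suc: "depends_on (d (Suc k)) (insert ?c (coords s k))"
    using d[of "Suc k"] by (simp only: coords_Suc)
  have int_upd: "integrable M (\<lambda>\<omega>. d (Suc k) ((noise \<omega>)(?c := j)))" for j
    by (rule integrable_noise[OF depends_on_fun_upd[OF d_Suc]])
  have int_d: "integrable M (\<lambda>\<omega>. d k (noise \<omega>))"
    by (rule integrable_noise[OF d])
  have "D (Suc k) = expectation (\<lambda>\<omega>. d (Suc k) (noise \<omega>))"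
    by (simp add: D_def d_def)
  also have "\<dots> = mean (\<lambda>j. expectation (\<lambda>\<omega>. d (Suc k) ((noise \<omega>)(?c := j))))"
    unfolding expectation_noise[OF c d_Suc] c_range by simp
  also have "\<dots> = expectation (\<lambda>\<omega>. mean (\<lambda>j. d (Suc k) ((noise \<omega>)(?c := j))))"
    using int_upd by (simp only: Bochner_Integration.integral_sum integral_mult_right_zero)
  also have "\<dots> \<le> expectation (\<lambda>\<omega>. d k (noise \<omega>)
      - 2 * \<alpha> * (1 - 2 * L * \<alpha>) * (F (inner_iter s k (noise \<omega>)) - Fmin)
      + 4 * \<alpha>\<^sup>2 * (L - \<mu>) * (F (outer s (noise \<omega>)) - Fmin))"
  proof (rule integral_mono)
    show "integrable M (\<lambda>\<omega>. mean (\<lambda>j. d (Suc k) ((noise \<omega>)(?c := j))))"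
      using int_upd by (intro integrable_mult_right Bochner_Integration.integrable_sum)
    show "integrable M (\<lambda>\<omega>. d k (noise \<omega>)
      - 2 * \<alpha> * (1 - 2 * L * \<alpha>) * (F (inner_iter s k (noise \<omega>)) - Fmin)
      + 4 * \<alpha>\<^sup>2 * (L - \<mu>) * (F (outer s (noise \<omega>)) - Fmin))"
      by (intro Bochner_Integration.integrable_add Bochner_Integration.integrable_diff
          integrable_mult_right int_d integrable_inner_gap integrable_outer_gap)
    show "mean (\<lambda>j. d (Suc k) ((noise \<omega>)(?c := j))) \<le> d k (noise \<omega>)
      - 2 * \<alpha> * (1 - 2 * L * \<alpha>) * (F (inner_iter s k (noise \<omega>)) - Fmin)
      + 4 * \<alpha>\<^sup>2 * (L - \<mu>) * (F (outer s (noise \<omega>)) - Fmin)" for \<omega>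
    proof -
      have "outer s ((noise \<omega>)(?c := j)) = outer s (noise \<omega>)" for j
        by (rule outer_cong[of s k]) (use c in auto)
      then show ?thesis
        unfolding d_def inner_iter_Suc_upd using svrp_step_bound[OF p \<alpha>] by simp
    qed
  qed
  also have "\<dots> = D k - 2 * \<alpha> * (1 - 2 * L * \<alpha>) * inner_gap s k + 4 * \<alpha>\<^sup>2 * (L - \<mu>) * outer_gap s"
    unfolding D_def inner_gap_def outer_gap_def d_def[symmetric]
    using int_d integrable_inner_gap integrable_outer_gap
    by (simp only: Bochner_Integration.integral_add Bochner_Integration.integral_diff
        Bochner_Integration.integrable_add Bochner_Integration.integrable_diff
        integrable_mult_right integral_mult_right_zero)
  finally show ?thesis .
qed

lemma sum_inner_gap_bound_approx:
  assumes c: "0 < c" "c < \<mu> / 2"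
  shows "2 * \<alpha> * (1 - 2 * L * \<alpha>) * (\<Sum>k<m. inner_gap s k)
    \<le> outer_gap s / c + real m * (4 * \<alpha>\<^sup>2 * (L - \<mu>) * outer_gap s)"
proof -
  have "\<exists>p. \<forall>x. F (p x) = Fmin \<and> c * (norm (x - p x))\<^sup>2 \<le> F x - Fmin"
    using quadratic_growth[OF c] by (intro choice) blast
  then obtain p where p: "\<And>x. F (p x) = Fmin" "\<And>x. c * (norm (x - p x))\<^sup>2 \<le> F x - Fmin"
    by blast
  define D where "D k = expectation (\<lambda>\<omega>. (norm (inner_iter s k (noise \<omega>) - p (outer s (noise \<omega>))))\<^sup>2)" for k
  have step: "D (Suc k) \<le> D k - 2 * \<alpha> * (1 - 2 * L * \<alpha>) * inner_gap s k + 4 * \<alpha>\<^sup>2 * (L - \<mu>) * outer_gap s" for k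
    unfolding D_def by (rule inner_distance_step[OF p(1)])
  have "D K + 2 * \<alpha> * (1 - 2 * L * \<alpha>) * (\<Sum>k<K. inner_gap s k)
      \<le> D 0 + real K * (4 * \<alpha>\<^sup>2 * (L - \<mu>) * outer_gap s)" for K
  proof (induction K)
    case (Suc K)
    then show ?case using step[of K] by (simp add: distrib_left distrib_right)
  qed simp
  moreover have "0 \<le> D m" unfolding D_def by (intro Bochner_Integration.integral_nonneg) simp
  moreover have "D 0 \<le> outer_gap s / c"
  proof -
    have "D 0 \<le> expectation (\<lambda>\<omega>. (F (outer s (noise \<omega>)) - Fmin) / c)"
      unfolding D_def inner_iter_0
    proof (rule integral_mono)
      show "integrable M (\<lambda>\<omega>. (norm (outer s (noise \<omega>) - p (outer s (noise \<omega>))))\<^sup>2)"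
        using integrable_noise[OF depends_on_iterates[of "\<lambda>_ x. (norm (x - p x))\<^sup>2" s 0]] .
      show "integrable M (\<lambda>\<omega>. (F (outer s (noise \<omega>)) - Fmin) / c)"
        by (intro integrable_divide_zero integrable_outer_gap)
    qed (use p(2) c in \<open>simp add: field_simps\<close>)
    then show ?thesis by (simp add: outer_gap_def)
  qed
  ultimately show ?thesis by (smt (verit))
qed

lemma sum_inner_gap_bound:
  "2 * \<alpha> * (1 - 2 * L * \<alpha>) * (\<Sum>k<m. inner_gap s k)
    \<le> outer_gap s / (\<mu> / 2) + real m * (4 * \<alpha>\<^sup>2 * (L - \<mu>) * outer_gap s)"
proof (rule tendsto_lowerbound)
  show "((\<lambda>c. outer_gap s / c + real m * (4 * \<alpha>\<^sup>2 * (L - \<mu>) * outer_gap s)) \<longlongrightarrow>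
      outer_gap s / (\<mu> / 2) + real m * (4 * \<alpha>\<^sup>2 * (L - \<mu>) * outer_gap s)) (at_left (\<mu> / 2))"
    using \<mu> by (intro tendsto_intros) auto
  show "\<forall>\<^sub>F c in at_left (\<mu> / 2). 2 * \<alpha> * (1 - 2 * L * \<alpha>) * (\<Sum>k<m. inner_gap s k)
      \<le> outer_gap s / c + real m * (4 * \<alpha>\<^sup>2 * (L - \<mu>) * outer_gap s)"
    using \<mu> by (intro eventually_at_leftI[of 0] sum_inner_gap_bound_approx) auto
qed simp

lemma outer_gap_Suc_le: "outer_gap (Suc s) \<le> 1 / real m * (\<Sum>k<m. inner_gap s k)"
proof (cases upd)
  case Random_Iterate
  have c: "Inl s \<notin> coords s m" by (auto simp: coords_def)
  have dep: "depends_on (\<lambda>g. F (outer (Suc s) g) - Fmin) (insert (Inl s) (coords s m))"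
    using depends_on_iterates[of "\<lambda>_ x. F x - Fmin" "Suc s" 0] by (simp only: coords_Suc_0)
  have "outer_gap (Suc s) = 1 / real m * (\<Sum>k<m. expectation (\<lambda>\<omega>.
      F (outer (Suc s) ((noise \<omega>)(Inl s := k))) - Fmin))"
    unfolding outer_gap_def expectation_noise[OF c dep]
    by (simp add: noise_range_def atLeast0LessThan)
  also have "\<dots> = 1 / real m * (\<Sum>k<m. inner_gap s k)"
    by (simp add: inner_gap_def outer_Suc_random_upd[OF Random_Iterate])
  finally show ?thesis by simp
next
  case Average_Iterate
  have "outer_gap (Suc s) \<le> expectation (\<lambda>\<omega>. 1 / real m * (\<Sum>k<m. F (inner_iter s k (noise \<omega>)) - Fmin))"
    unfolding outer_gap_def
  proof (rule integral_mono[OF integrable_outer_gap])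
    show "integrable M (\<lambda>\<omega>. 1 / real m * (\<Sum>k<m. F (inner_iter s k (noise \<omega>)) - Fmin))"
      by (intro integrable_mult_right Bochner_Integration.integrable_sum integrable_inner_gap)
    fix \<omega>
    let ?x = "\<lambda>k. inner_iter s k (noise \<omega>)"
    have "F (\<Sum>k<m. (1 / real m) *\<^sub>R ?x k) \<le> (\<Sum>k<m. 1 / real m * F (?x k))"
      using m by (intro convex_on_sum[OF _ _ F_convex]) (auto simp: lessThan_empty_iff)
    then show "F (outer (Suc s) (noise \<omega>)) - Fmin \<le> 1 / real m * (\<Sum>k<m. F (?x k) - Fmin)"
      using m by (simp add: outer_Suc_average[OF Average_Iterate] scaleR_right.sum sum_subtractf
          right_diff_distrib sum_divide_distrib diff_divide_distrib)
  qed
  also have "\<dots> = 1 / real m * (\<Sum>k<m. inner_gap s k)"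
    using integrable_inner_gap
    by (simp only: inner_gap_def Bochner_Integration.integral_sum integral_mult_right_zero)
  finally show ?thesis .
qed

lemma outer_gap_contraction:
  assumes small: "2 * L * \<alpha> < 1"
  shows "outer_gap (Suc s)
    \<le> (1 / (\<mu> * \<alpha> * (1 - 2 * L * \<alpha>) * real m) + 2 * \<alpha> * (L - \<mu>) / (1 - 2 * L * \<alpha>)) * outer_gap s"
proof -
  define \<beta> where "\<beta> = 1 - 2 * L * \<alpha>"
  have pos: "\<beta> > 0" "real m > 0" using small m by (auto simp: \<beta>_def)
  have "1 / real m * (\<Sum>k<m. inner_gap s k)
      = (2 * \<alpha> * \<beta> * (\<Sum>k<m. inner_gap s k)) / (2 * \<alpha> * \<beta> * real m)"
    using pos \<alpha> by (simp add: field_simps)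
  also have "\<dots> \<le> (outer_gap s / (\<mu> / 2) + real m * (4 * \<alpha>\<^sup>2 * (L - \<mu>) * outer_gap s)) / (2 * \<alpha> * \<beta> * real m)"
    using sum_inner_gap_bound[of s] pos \<alpha> by (intro divide_right_mono) (auto simp: \<beta>_def)
  also have "\<dots> = (1 / (\<mu> * \<alpha> * \<beta> * real m) + 2 * \<alpha> * (L - \<mu>) / \<beta>) * outer_gap s"
    using pos \<alpha> \<mu> by (simp add: field_simps power2_eq_square)
  finally show ?thesis
    using outer_gap_Suc_le[of s] by (simp add: \<beta>_def)
qed

lemma outer_gap_0: "outer_gap 0 = F x0 - Fmin"
  by (simp add: outer_gap_def outer_def prob_space)

lemma outer_gap_geometric:
  assumes small: "2 * L * \<alpha> < 1" and \<mu>_le: "\<mu> \<le> L"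
  defines "q \<equiv> 1 / (\<mu> * \<alpha> * (1 - 2 * L * \<alpha>) * real m) + 2 * \<alpha> * (L - \<mu>) / (1 - 2 * L * \<alpha>)"
  shows "outer_gap s \<le> q ^ s * (F x0 - Fmin)"
proof (induction s)
  case (Suc s)
  have "0 \<le> q" using small \<mu>_le \<mu> \<alpha> by (simp add: q_def)
  have "outer_gap (Suc s) \<le> q * outer_gap s"
    unfolding q_def by (rule outer_gap_contraction[OF small])
  also have "\<dots> \<le> q * (q ^ s * (F x0 - Fmin))"
    by (rule mult_left_mono[OF Suc.IH \<open>0 \<le> q\<close>])
  finally show ?case by simp
qed (simp add: outer_gap_0)

end

theorem theorem4p7:
  fixes f :: "nat \<Rightarrow> 'a::{real_inner, polish_space} \<Rightarrow> real"
    and F :: "'a \<Rightarrow> real"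
    and n m :: nat
    and L \<mu> \<alpha> :: real
    and x0 :: 'a
    and M :: "'w measure"
    and \<xi> i :: "nat \<Rightarrow> 'w \<Rightarrow> nat"
    and upd :: svrp_update
  assumes n: "n \<ge> 1"
    and F: "F = average n f"
    and argmin: "\<exists>x. is_arg_min F (\<lambda>_. True) x"
    and convex: "\<And>j. j \<in> {1..n} \<Longrightarrow> convex_on UNIV (f j)"
    and L: "L > 0"
    and smooth: "\<And>j. j \<in> {1..n} \<Longrightarrow> L_smooth L (f j)"
    and \<mu>: "\<mu> > 0"
    and PL: "PL_condition \<mu> F"
    and M: "prob_space M"
    and xi_indep: "prob_space.indep_vars M (\<lambda>_. count_space UNIV) \<xi> UNIV"
    and xi_unif: "\<And>s. distr M (count_space UNIV) (\<xi> s) = measure_pmf (pmf_of_set {0..<m})"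
    and i_indep: "prob_space.indep_vars M (\<lambda>_. count_space UNIV) i UNIV"
    and i_unif: "\<And>t. distr M (count_space UNIV) (i t) = measure_pmf (pmf_of_set {1..n})"
    and xi_i_indep: "prob_space.indep_var M
          (\<Pi>\<^sub>M s\<in>UNIV. count_space UNIV) (\<lambda>\<omega> s. \<xi> s \<omega>)
          (\<Pi>\<^sub>M t\<in>UNIV. count_space UNIV) (\<lambda>\<omega> t. i t \<omega>)"
    and m: "m \<ge> 1"
    and \<alpha>: "0 < \<alpha>" "\<alpha> < 1 / (2 * (2 * L - \<mu>))"
    and m_large: "real m > 1 / (\<mu> * \<alpha> * (1 - 2 * \<alpha> * (2 * L - \<mu>)))"
  shows "let q = 1 / (\<mu> * \<alpha> * (1 - 2 * L * \<alpha>) * real m) + 2 * \<alpha> * (L - \<mu>) / (1 - 2 * L * \<alpha>);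
             Fmin = (INF x. F x);
             xt = (\<lambda>s \<omega>. svrp upd \<alpha> m n f x0 (\<lambda>t. \<xi> t \<omega>) (\<lambda>t. i t \<omega>) s)
         in (\<forall>s. integrable M (\<lambda>\<omega>. F (xt (Suc s) \<omega>) - Fmin) \<and>
                 prob_space.expectation M (\<lambda>\<omega>. F (xt (Suc s) \<omega>) - Fmin) \<le> q ^ s * (F x0 - Fmin)) \<and>
            ((\<exists>x. F x \<noteq> Fmin) \<or> 2 * L * \<alpha> < 1 \<longrightarrow> q < 1)"
proof -
  have "2 * L - \<mu> > 0"
  proof (rule ccontr)
    assume "\<not> 2 * L - \<mu> > 0"
    then have "1 / (2 * (2 * L - \<mu>)) \<le> 0" by (simp add: divide_nonneg_nonpos)
    with \<alpha> show False by linarith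
  qed
  with \<alpha> have \<alpha>_small: "2 * \<alpha> * (2 * L - \<mu>) < 1"
    by (simp add: field_simps)
  have "finite_sum_PL f n L \<mu>"
    using assms by (intro finite_sum_PL.intro) auto
  moreover have "svrp_process_axioms n M m \<alpha> \<xi> i"
    using assms by (intro svrp_process_axioms.intro) auto
  ultimately interpret svrp_process f n L \<mu> M m \<alpha> x0 \<xi> i upd
    using M by (intro svrp_process.intro)
  let ?q = "1 / (\<mu> * \<alpha> * (1 - 2 * L * \<alpha>) * real m) + 2 * \<alpha> * (L - \<mu>) / (1 - 2 * L * \<alpha>)"
  let ?Fmin = "INF x. F x"
  have xt: "svrp upd \<alpha> m n f x0 (\<lambda>t. \<xi> t \<omega>) (\<lambda>t. i t \<omega>) s = outer s (noise \<omega>)" for s \<omega>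
    by (simp add: outer_def noise_def)
  have Fmin_le': "?Fmin \<le> F x" for x unfolding F by (rule Fmin_le)
  have q_less: "?q < 1" if "2 * L * \<alpha> < 1"
  proof -
    define \<gamma> where "\<gamma> = 1 - 2 * \<alpha> * (2 * L - \<mu>)"
    define \<beta> where "\<beta> = 1 - 2 * L * \<alpha>"
    have pos: "\<gamma> > 0" "\<beta> > 0" "real m > 0" using \<alpha>_small that m by (auto simp: \<gamma>_def \<beta>_def)
    have "1 / (\<mu> * \<alpha> * real m) < \<gamma>"
      using m_large pos \<mu> \<alpha> unfolding \<gamma>_def[symmetric] by (simp add: field_simps)
    moreover have "\<gamma> = \<beta> - 2 * \<alpha> * (L - \<mu>)"
      by (simp add: \<gamma>_def \<beta>_def algebra_simps)
    ultimately have "(1 / (\<mu> * \<alpha> * real m) + 2 * \<alpha> * (L - \<mu>)) / \<beta> < 1"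
      using pos by simp
    then show ?thesis
      unfolding \<beta>_def[symmetric] by (simp add: add_divide_distrib mult.commute mult.left_commute)
  qed
  have main: "outer_gap (Suc s) \<le> ?q ^ s * (F x0 - ?Fmin) \<and> ((\<exists>x. F x \<noteq> ?Fmin) \<longrightarrow> ?q < 1)" for s
  proof (cases "\<exists>x. F x \<noteq> ?Fmin")
    case True
    then have \<mu>_L: "\<mu> \<le> L" unfolding F using \<mu>_le_L by blast
    then have "2 * \<alpha> * L \<le> 2 * \<alpha> * (2 * L - \<mu>)"
      using \<alpha> by (intro mult_left_mono) auto
    with \<alpha>_small have small: "2 * L * \<alpha> < 1" by (simp add: mult.commute mult.left_commute)
    have "0 \<le> ?q" using small \<mu>_L \<mu> \<alpha> by simp
    have "outer_gap (Suc s) \<le> ?q ^ Suc s * (F x0 - ?Fmin)"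
      using outer_gap_geometric[OF small \<mu>_L] unfolding F .
    also have "\<dots> \<le> ?q ^ s * (F x0 - ?Fmin)"
      using \<open>0 \<le> ?q\<close> q_less[OF small] Fmin_le'[of x0]
      by (intro mult_right_mono power_decreasing) auto
    finally show ?thesis using q_less[OF small] by blast
  next
    case False
    then have const: "F x - ?Fmin = 0" for x
      by (intro right_minus_eq[THEN iffD2]) blast
    show ?thesis
    proof
      show "outer_gap (Suc s) \<le> ?q ^ s * (F x0 - ?Fmin)"
        unfolding outer_gap_def F[symmetric] const by simp
    qed (use False in blast)
  qed
  show ?thesis
    unfolding Let_def xt
    using main integrable_outer_gap q_less unfolding outer_gap_def F[symmetric] by blast
qed

end
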